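(* Let $p,q,n$ be positive integers with $p+q$ odd, and let $a,b\in\{1,-1\}$, with $p\neq 1$ when $b=1$, and $q\neq 1$ when $a=1$. For a positive integer $k$ put $\mathcal{H}_{k}^{(p)}(b)=\sum_{m=1}^{k}\frac{b^{m-1}}{m^p}$. Then $$\begin{aligned}\sum_{k=1}^\infty (a^n)^{k}\,\mathcal{H}_k^{(p)}(b)\sum_{j=1}^{n}\frac{a^{j-1}}{(nk+j)^q}={}&-\tfrac12a^{n-1}n^{-q}\,\Phi(a^nb,p+q,1)+\tfrac12(1+(-1)^{q})\,\Phi(a,q,1)\,\Phi(b,p,1)\\ &-a^{n-1}b(-n)^{-q}\sum_{j=0}^{\lfloor q/2\rfloor}\binom{p+q-2j-1}{p-1}\Phi(a^nb,2j,1)\,\Phi(b,p+q-2j,1)\\ &+a^n(-n)^{p}\sum_{k=0}^{\lfloor p/2\rfloor}\binom{p+q-2k-1}{q-1}n^{-2k}\,\Phi(a^nb,2k,1)\,\Phi(a,p+q-2k,1)\\ &-\tfrac12(-n)^{-q}\sum_{j=2}^{n}\sum_{k=1}^{q}\binom{p+q-k-1}{p-1}a^{j}(-1)^{k}\,\Theta(a^nb,k,j-1,n)\,\Phi\!\left(b,p+q-k,\tfrac{n-j+1}{n}\right).\end{aligned}$$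
   Context: Lerch function: for $c=\pm1$, integer $q\ge1$ (with $q\neq1$ if $c=1$) and $\alpha>0$, $\Phi(c,q,\alpha)=\sum_{m=0}^\infty \frac{c^m}{(m+\alpha)^q}$. At $q=0$, $\alpha=1$ the values by analytic continuation are used: $\Phi(1,0,1)=\zeta(0)=-\tfrac12$ and $\Phi(-1,0,1)=\eta(0)=\tfrac12$. For $c=\pm1$, integer $k\ge 1$ and $0<s<r$: $\Theta(c,k,s,r)=\Phi(c,k,\tfrac{s}{r})+c(-1)^{k}\Phi(c,k,\tfrac{r-s}{r})$ if $(c,k)\ne(1,1)$, and $\Theta(1,1,s,r)=\pi\cot(\pi s/r)$. Empty sums are $0$. *)

theory Defs
  imports "HOL-Analysis.Analysis"
begin

text \<open>
  The Lerch function for \<open>c = \<plusminus>1\<close>. The sum is the limit of the partial sums in the natural order,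
  so the conditionally convergent case \<open>c = -1\<close>, \<open>q = 1\<close> is covered. For \<open>q = 0\<close>, \<open>\<alpha> = 1\<close> the
  series diverges and the values are those of the analytic continuation,
  \<open>\<zeta>(0) = -1/2\<close> and \<open>\<eta>(0) = 1/2\<close>. The function is not meant to be used at \<open>c = 1\<close>, \<open>q = 1\<close>,
  nor at \<open>q = 0\<close> with \<open>\<alpha> \<noteq> 1\<close>.
\<close>

definition lerch_Phi :: "real \<Rightarrow> nat \<Rightarrow> real \<Rightarrow> real" where
  "lerch_Phi c q \<alpha> =
     (if q = 0 \<and> \<alpha> = 1 then (if c = 1 then - 1 / 2 else 1 / 2)
      else (\<Sum>m. c ^ m / (real m + \<alpha>) ^ q))"

definition lerch_Theta :: "real \<Rightarrow> nat \<Rightarrow> real \<Rightarrow> real \<Rightarrow> real" where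
  "lerch_Theta c k s r =
     (if c = 1 \<and> k = 1 then pi * cot (pi * s / r)
      else lerch_Phi c k (s / r) + c * (- 1) ^ k * lerch_Phi c k ((r - s) / r))"

definition gen_harm :: "nat \<Rightarrow> real \<Rightarrow> nat \<Rightarrow> real" where
  "gen_harm p b k = (\<Sum>m=1..k. b ^ (m - 1) / real m ^ p)"

end

theory Submission
  imports Defs "HOL-Real_Asymp.Real_Asymp"
begin

text \<open>
  Writing \<open>N = n k + j\<close>, the left-hand side is, up to the sign \<open>a b\<close>, the double sum of
  \<open>X(m, N) = b^m a^N / (m^p N^q)\<close> over the cone \<open>m \<ge> 1, N > n m\<close>. Since \<open>p + q\<close> is odd,
  \<open>X(-m, -N) = - X(m, N)\<close>, and splitting the half plane \<open>N < n m\<close> (without the axes) into its three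
  sectors expresses twice the cone sum through the product of the two single series, the diagonal
  \<open>N = n m\<close>, and the half plane sum. All of this holds exactly on the box \<open>|m| \<le> M, |N| \<le> n M\<close>,
  so no conditionally convergent rearrangement is involved.

  In the half plane put \<open>N = n u + s\<close> with \<open>0 \<le> s < n\<close> and \<open>m = u + e\<close> with \<open>e \<ge> 1\<close>. The partial fractions of
  \<open>1 / ((y + d)^p y^q)\<close> with \<open>y = u + s/n\<close> and \<open>d = e - s/n\<close> decouple the summations: the sums over
  \<open>u\<close> are bilateral and give \<open>\<Theta>\<close> (for \<open>c = k = 1\<close> the cotangent series), or for integer points only
  even zeta-like values, while the sums over \<open>e\<close> are one-sided Lerch series. The excluded poles
  \<open>N = 0\<close> and \<open>m = 0\<close> account for the terms with \<open>\<Phi>(a^n b, 0, 1)\<close>.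

  The truncated sums have the form \<open>\<Sum>\<^sub>u g(u) H(M - u)\<close> with \<open>g(u) = O(1 / (1 + |u|))\<close> and
  \<open>L - H(t) = O(1 / t)\<close>, even when the series involved converge only conditionally; this suffices
  for the limit \<open>(\<Sum>\<^sub>u g(u)) L\<close>.
\<close>

subsection \<open>Partial fractions\<close>

text \<open>\<open>A y d P Q\<close> is the principal part at the pole \<open>y = 0\<close>;
  replacing \<open>y\<close>, \<open>d\<close>, \<open>P\<close>, \<open>Q\<close> by
  \<open>y + d\<close>, \<open>- d\<close>, \<open>Q\<close>, \<open>P\<close> gives the one at
  \<open>y + d = 0\<close>. Multiplying by \<open>d = (y + d) - y\<close> lowers one of the two
  exponents, and both sides obey the resulting recurrence, so induction on \<open>P + Q\<close>
  applies.\<close>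

lemma partial_fractions_aux:
  fixes y d :: real and A :: "real \<Rightarrow> real \<Rightarrow> nat \<Rightarrow> nat \<Rightarrow> real"
  defines "A \<equiv> \<lambda>y d P Q. \<Sum>j\<le>Q. real ((P + j) choose P) * (- 1) ^ j / (y ^ (Q + 1 - j) * d ^ (P + 1 + j))"
  assumes "d \<noteq> 0" "y \<noteq> 0" "y + d \<noteq> 0"
  shows "1 / ((y + d) ^ (P + 1) * y ^ (Q + 1)) = A y d P Q + A (y + d) (- d) Q P"
proof -
  \<comment> \<open>Shifting the second sum by one index flips its sign, so that Pascal's rule
    merges the coefficients. The added term \<open>j = 0\<close> vanishes because
    \<open>P choose Suc P = 0\<close>.\<close>
  have rec: "d * A y d (Suc P) (Suc Q) = A y d P (Suc Q) - A y d (Suc P) Q"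
    if "d \<noteq> 0" "y \<noteq> 0" for y d P Q
  proof -
    have "A y d (Suc P) Q = (\<Sum>j\<le>Suc Q. - (real ((P + j) choose Suc P) * (- 1) ^ j / (y ^ (Q + 2 - j) * d ^ (P + 1 + j))))"
      unfolding A_def by (subst sum.atMost_Suc_shift) (simp add: binomial_eq_0)
    then have "A y d P (Suc Q) - A y d (Suc P) Q
        = (\<Sum>j\<le>Suc Q. real ((P + j) choose P) * (- 1) ^ j / (y ^ (Suc Q + 1 - j) * d ^ (P + 1 + j))
           + real ((P + j) choose Suc P) * (- 1) ^ j / (y ^ (Q + 2 - j) * d ^ (P + 1 + j)))"
      unfolding A_def by (simp only: sum_negf diff_minus_eq_add sum.distrib)
    also have "\<dots> = (\<Sum>j\<le>Suc Q. d * (real ((Suc P + j) choose Suc P) * (- 1) ^ j / (y ^ (Suc Q + 1 - j) * d ^ (Suc P + 1 + j))))"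
      using that by (intro sum.cong refl) (simp add: divide_simps, simp add: algebra_simps)
    also have "\<dots> = d * A y d (Suc P) (Suc Q)"
      unfolding A_def sum_distrib_left ..
    finally show ?thesis by simp
  qed
  have rec0: "d * A y d 0 (Suc Q) = 1 / y ^ (Q + 2) - A y d 0 Q" if "d \<noteq> 0" "y \<noteq> 0" for y d Q
  proof -
    have "A y d 0 (Suc Q) = 1 / (y ^ (Q + 2) * d) + (\<Sum>j\<le>Q. - ((- 1) ^ j / (y ^ (Q + 1 - j) * d ^ (2 + j))))"
      unfolding A_def by (subst sum.atMost_Suc_shift) simp
    also have "d * \<dots> = 1 / y ^ (Q + 2) - A y d 0 Q"
      using that unfolding A_def
      by (simp add: right_diff_distrib sum_negf sum_distrib_left)
    finally show ?thesis .
  qed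
  have base: "1 / ((y + d) * y ^ (Q + 1)) = A y d 0 Q + A (y + d) (- d) Q 0"
    if "d \<noteq> 0" "y \<noteq> 0" "y + d \<noteq> 0" for y d Q
  proof (induction Q)
    case 0
    show ?case using that by (simp add: A_def divide_simps)
  next
    case (Suc Q)
    have "A (y + d) (- d) (Suc Q) 0 = - A (y + d) (- d) Q 0 / d"
      using that unfolding A_def by (simp add: divide_simps)
    then have "d * (A y d 0 (Suc Q) + A (y + d) (- d) (Suc Q) 0)
        = 1 / y ^ (Q + 2) - 1 / ((y + d) * y ^ (Q + 1))"
      using that by (simp only: distrib_left rec0[OF that(1,2)] Suc.IH) simp
    also have "\<dots> = d * (1 / ((y + d) * y ^ (Suc Q + 1)))"
      using that by (simp add: divide_simps)
    finally show ?case unfolding mult_left_cancel[OF that(1)] by simp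
  qed
  show ?thesis
    using assms(2-4)
  proof (induction "P + Q" arbitrary: P Q rule: less_induct)
    case (less P Q)
    consider "P = 0" | "Q = 0" | P' Q' where "P = Suc P'" "Q = Suc Q'"
      by (metis not0_implies_Suc)
    then show ?case
    proof cases
      case 1
      then show ?thesis using base[OF less.prems] by simp
    next
      case 2
      \<comment> \<open>Moving the origin to the other pole exchanges \<open>P\<close> and
        \<open>Q\<close>, so this is again the case of a simple pole.\<close>
      then show ?thesis using base[of "- d" "y + d" P] less.prems by (simp add: mult.commute)
    next
      case (3 P' Q')
      have "d * (A y d P Q + A (y + d) (- d) Q P)
          = d * A y d (Suc P') (Suc Q') - (- d) * A (y + d) (- d) (Suc Q') (Suc P')"
        by (simp add: 3 algebra_simps)
      also have "\<dots> = (A y d P' (Suc Q') + A (y + d) (- d) (Suc Q') P')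
          - (A y d (Suc P') Q' + A (y + d) (- d) Q' (Suc P'))"
        using less.prems by (subst (1 2) rec) auto
      also have "\<dots> = 1 / ((y + d) ^ (P' + 1) * y ^ (Suc Q' + 1)) - 1 / ((y + d) ^ (Suc P' + 1) * y ^ (Q' + 1))"
        using less.hyps[of P' "Suc Q'"] less.hyps[of "Suc P'" Q'] less.prems 3 by simp
      also have "\<dots> = d * (1 / ((y + d) ^ (P + 1) * y ^ (Q + 1)))"
        using less.prems 3 by (simp add: divide_simps)
      finally show ?thesis unfolding mult_left_cancel[OF less.prems(1)] by simp
    qed
  qed
qed

lemma sum_reflect_index:
  fixes f :: "nat \<Rightarrow> 'a::comm_monoid_add"
  shows "(\<Sum>k=1..Suc Q. f k) = (\<Sum>j\<le>Q. f (Suc Q - j))"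
  by (rule sum.reindex_bij_witness[of _ "\<lambda>j. Suc Q - j" "\<lambda>k. Suc Q - k"]) auto

text \<open>The hockey-stick identity. It evaluates the partial fraction sum at a pole, where all
  surviving terms have the same power of \<open>d\<close>.\<close>

lemma sum_choose_reflected:
  assumes "p \<ge> 1" "q \<ge> 1"
  shows "(\<Sum>k=1..q. real ((p + q - k - 1) choose (p - 1))) = real ((p + q - 1) choose p)"
proof -
  obtain P Q where [simp]: "p = Suc P" "q = Suc Q"
    using assms by (metis Suc_le_D One_nat_def)
  have "(\<Sum>k=1..Suc Q. real ((p + q - k - 1) choose (p - 1))) = (\<Sum>j\<le>Q. real ((P + j) choose P))"
    unfolding sum_reflect_index by (intro sum.cong) auto
  also have "\<dots> = real ((Suc P + Q) choose Suc P)"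
    by (induction Q) auto
  finally show ?thesis by simp
qed

text \<open>Since \<open>x / 0 = 0\<close>, the last two terms are needed to correct the poles \<open>y = 0\<close> and \<open>y + d = 0\<close>.\<close>

lemma partial_fractions:
  fixes y d :: real
  assumes "p \<ge> 1" "q \<ge> 1" "d \<noteq> 0"
  shows "1 / ((y + d) ^ p * y ^ q) =
      (\<Sum>k=1..q. real ((p + q - k - 1) choose (p - 1)) * (- 1) ^ (q + k) / (y ^ k * d ^ (p + q - k)))
    + (- 1) ^ q * (\<Sum>i=1..p. real ((p + q - i - 1) choose (q - 1)) / ((y + d) ^ i * d ^ (p + q - i)))
    - (if y = 0 then (- 1) ^ q * real ((p + q - 1) choose q) / d ^ (p + q) else 0)
    - (if y + d = 0 then (- 1) ^ q * real ((p + q - 1) choose p) / d ^ (p + q) else 0)"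
proof -
  obtain P Q where pq[simp]: "p = Suc P" "q = Suc Q"
    using assms by (metis Suc_le_D One_nat_def)
  have s1: "(\<Sum>k=1..q. real ((p + q - k - 1) choose (p - 1)) * (- 1) ^ (q + k) / (y ^ k * d ^ (p + q - k)))
      = (\<Sum>j\<le>Q. real ((P + j) choose P) * (- 1) ^ j / (y ^ (Q + 1 - j) * d ^ (P + 1 + j)))"
    unfolding pq(2) sum_reflect_index
    by (intro sum.cong refl) (auto simp: uminus_power_if)
  have s2: "(- 1) ^ q * (\<Sum>i=1..p. real ((p + q - i - 1) choose (q - 1)) / ((y + d) ^ i * d ^ (p + q - i)))
      = (\<Sum>j\<le>P. real ((Q + j) choose Q) * (- 1) ^ j / ((y + d) ^ (P + 1 - j) * (- d) ^ (Q + 1 + j)))"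
    unfolding pq(1) sum_reflect_index sum_distrib_left
    by (intro sum.cong refl) (auto simp: uminus_power_if add.commute)
  consider "y = 0" | "y \<noteq> 0" "y + d = 0" | "y \<noteq> 0" "y + d \<noteq> 0" by blast
  then show ?thesis
  proof cases
    case 1
    \<comment> \<open>At \<open>y = 0\<close> the left-hand side and the whole sum over
      \<open>k\<close> are 0 by convention; the sum over \<open>i\<close> collapses to a multiple of
      \<open>1 / d ^ (p + q)\<close> and has to be cancelled by the correction term.\<close>
    have "(\<Sum>i=1..p. real ((p + q - i - 1) choose (q - 1)) / ((y + d) ^ i * d ^ (p + q - i)))
        = (\<Sum>i=1..p. real ((q + p - i - 1) choose (q - 1))) / d ^ (p + q)"
      unfolding sum_divide_distrib using 1
      by (intro sum.cong refl) (auto simp: add.commute simp flip: power_add)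
    also have "\<dots> = real ((p + q - 1) choose q) / d ^ (p + q)"
      using sum_choose_reflected[of q p] assms by (simp add: add.commute)
    finally have e: "(\<Sum>i=1..p. real ((p + q - i - 1) choose (q - 1)) / ((y + d) ^ i * d ^ (p + q - i)))
        = real ((p + q - 1) choose q) / d ^ (p + q)" .
    have "(\<Sum>k=1..q. real ((p + q - k - 1) choose (p - 1)) * (- 1) ^ (q + k) / (y ^ k * d ^ (p + q - k))) = 0"
      using 1 by (intro sum.neutral) auto
    then show ?thesis unfolding e using 1 assms by simp
  next
    case 2
    then have y: "y = - d" by simp
    \<comment> \<open>Here \<open>y ^ k = (- d) ^ k\<close>, whose sign cancels the \<open>k\<close>
      in \<open>(- 1) ^ (q + k)\<close>.\<close>
    have "(\<Sum>k=1..q. real ((p + q - k - 1) choose (p - 1)) * (- 1) ^ (q + k) / (y ^ k * d ^ (p + q - k)))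
        = (\<Sum>k=1..q. real ((p + q - k - 1) choose (p - 1))) * ((- 1) ^ q / d ^ (p + q))"
      unfolding sum_distrib_right
    proof (intro sum.cong refl)
      fix k assume k: "k \<in> {1..q}"
      have "y ^ k * d ^ (p + q - k) = (- 1) ^ k * d ^ (p + q)"
        using k unfolding y by (subst power_minus) (simp flip: power_add)
      then show "real ((p + q - k - 1) choose (p - 1)) * (- 1) ^ (q + k) / (y ^ k * d ^ (p + q - k))
          = real ((p + q - k - 1) choose (p - 1)) * ((- 1) ^ q / d ^ (p + q))"
        by (simp add: power_add)
    qed
    moreover have "(\<Sum>i=1..p. real ((p + q - i - 1) choose (q - 1)) / ((y + d) ^ i * d ^ (p + q - i))) = 0"
      using 2 by (intro sum.neutral) auto
    ultimately show ?thesis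
      using 2 sum_choose_reflected[of p q] assms by simp
  next
    case 3
    then show ?thesis
      using partial_fractions_aux[of d y P Q] assms unfolding s1 s2 by simp
  qed
qed

subsection \<open>Truncated convolutions\<close>

text \<open>The half-open window pairs \<open>v\<close> with \<open>- 1 - v\<close>, so both halves
  have the same length. Under this pairing the shift \<open>\<sigma>\<close> on one side becomes
  \<open>1 - \<sigma>\<close> on the other, as in \<open>lerch_Theta\<close>.\<close>

lemma sum_symmetric_int:
  fixes f :: "int \<Rightarrow> 'a::comm_monoid_add"
  shows "(\<Sum>u\<in>{- int M..<int M}. f u) = (\<Sum>u<M. f (int u)) + (\<Sum>v<M. f (- 1 - int v))"
proof (induction M)
  case (Suc M)
  have "{- int (Suc M)..<int (Suc M)} = insert (int M) (insert (- 1 - int M) {- int M..<int M})"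
    by auto
  then show ?case using Suc by (simp add: ac_simps)
qed simp

text \<open>A crude bound on harmonic numbers by telescoping square roots; anything of order
  \<open>o(t)\<close> is enough for the kernel estimate that follows.\<close>

lemma sum_inverse_le_sqrt: "(\<Sum>j<t. 1 / (real j + 1)) \<le> 2 * sqrt (real t)"
proof (induction t)
  case (Suc t)
  have "1 / (real t + 1) \<le> 2 * (sqrt (real (Suc t)) - sqrt (real t))"
  proof -
    define x y where "x = sqrt (real (Suc t))" and "y = sqrt (real t)"
    have xy: "x > 0" "y \<ge> 0" "y \<le> x" "x \<ge> 1" "x ^ 2 = real t + 1" "y ^ 2 = real t"
      by (auto simp: x_def y_def)
    have "(x - y) * (x + y) = 1" using xy by (simp add: algebra_simps power2_eq_square)
    then have "x - y = 1 / (x + y)" using xy by (simp add: field_simps)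
    also have "\<dots> \<ge> 1 / (2 * x)" using xy by (intro divide_left_mono) auto
    finally have "2 * (x - y) \<ge> 1 / x" by (simp add: field_simps)
    moreover have "1 / x \<ge> 1 / x ^ 2" using xy by (intro divide_left_mono self_le_power) auto
    ultimately show ?thesis using xy unfolding x_def y_def by (simp add: add.commute)
  qed
  then show ?case using Suc by simp
qed simp

text \<open>By \<open>1 / (x * y) = (1 / x + 1 / y) / (x + y)\<close> and
  \<open>x + y \<ge> M + 2\<close>, the kernel is at most two harmonic-type sums divided by
  \<open>M + 2\<close>, hence of order \<open>1 / sqrt M\<close>.\<close>

lemma convolution_kernel_tendsto_0:
  "(\<lambda>M. \<Sum>u\<in>{- int M..<int M}. 1 / ((1 + \<bar>real_of_int u\<bar>) * (1 + (real M - real_of_int u)))) \<longlonglongrightarrow> 0"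
proof (rule Lim_null_comparison)
  show "(\<lambda>M. (4 * sqrt (real M) + 2 * sqrt (2 * real M + 1)) / (real M + 2)) \<longlonglongrightarrow> 0"
    by real_asymp
  show "\<forall>\<^sub>F M in sequentially. norm (\<Sum>u\<in>{- int M..<int M}. 1 / ((1 + \<bar>real_of_int u\<bar>) * (1 + (real M - real_of_int u))))
      \<le> (4 * sqrt (real M) + 2 * sqrt (2 * real M + 1)) / (real M + 2)"
  proof (intro always_eventually allI)
    fix M :: nat
    let ?x = "\<lambda>u::int. 1 + \<bar>real_of_int u\<bar>" and ?y = "\<lambda>u::int. 1 + (real M - real_of_int u)"
    have "norm (\<Sum>u\<in>{- int M..<int M}. 1 / (?x u * ?y u)) = (\<Sum>u\<in>{- int M..<int M}. 1 / (?x u * ?y u))"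
      unfolding real_norm_def by (intro abs_of_nonneg sum_nonneg) auto
    also have "\<dots> \<le> (\<Sum>u\<in>{- int M..<int M}. (1 / ?x u + 1 / ?y u) / (real M + 2))"
    proof (intro sum_mono)
      fix u assume "u \<in> {- int M..<int M}"
      then have xy: "?x u > 0" "?y u > 0" "?x u + ?y u \<ge> real M + 2" by auto
      have "1 / (?x u * ?y u) = (1 / ?x u + 1 / ?y u) / (?x u + ?y u)"
        using xy by (simp add: divide_simps)
      also have "\<dots> \<le> (1 / ?x u + 1 / ?y u) / (real M + 2)"
        using xy by (intro divide_left_mono) auto
      finally show "1 / (?x u * ?y u) \<le> (1 / ?x u + 1 / ?y u) / (real M + 2)" .
    qed
    also have "\<dots> = ((\<Sum>u\<in>{- int M..<int M}. 1 / ?x u) + (\<Sum>u\<in>{- int M..<int M}. 1 / ?y u)) / (real M + 2)"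
      by (simp add: sum.distrib flip: sum_divide_distrib)
    also have "\<dots> \<le> ((2 * sqrt (real M) + 2 * sqrt (real M)) + 2 * sqrt (2 * real M + 1)) / (real M + 2)"
    proof (intro divide_right_mono add_mono)
      have "(\<Sum>v<M. 1 / ?x (- 1 - int v)) \<le> (\<Sum>v<M. 1 / (real v + 1))"
        by (intro sum_mono divide_left_mono) auto
      then show "(\<Sum>u\<in>{- int M..<int M}. 1 / ?x u) \<le> 2 * sqrt (real M) + 2 * sqrt (real M)"
        using sum_inverse_le_sqrt[of M] unfolding sum_symmetric_int by (simp add: add.commute)
      have "(\<Sum>u\<in>{- int M..<int M}. 1 / ?y u) = (\<Sum>j\<in>{1..2 * M}. 1 / (real j + 1))"
        by (rule sum.reindex_bij_witness[of _ "\<lambda>j. int M - int j" "\<lambda>u. nat (int M - u)"]) auto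
      also have "\<dots> \<le> (\<Sum>j<2 * M + 1. 1 / (real j + 1))"
        by (intro sum_mono2) auto
      also have "\<dots> \<le> 2 * sqrt (real (2 * M + 1))" by (rule sum_inverse_le_sqrt)
      finally show "(\<Sum>u\<in>{- int M..<int M}. 1 / ?y u) \<le> 2 * sqrt (2 * real M + 1)" by (simp add: add.commute)
    qed auto
    also have "\<dots> \<le> (4 * sqrt (real M) + 2 * sqrt (2 * real M + 1)) / (real M + 2)"
      by simp
    finally show "norm (\<Sum>u\<in>{- int M..<int M}. 1 / (?x u * ?y u))
      \<le> (4 * sqrt (real M) + 2 * sqrt (2 * real M + 1)) / (real M + 2)" .
  qed
qed

text \<open>Write \<open>H = L - (L - H)\<close>. The constant part gives \<open>G * L\<close> from
  the symmetric partial sums of \<open>g\<close>; the remainder is dominated by \<open>C * D\<close>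
  times the kernel above, so \<open>g\<close> may be only conditionally summable.\<close>

lemma tendsto_symmetric_convolution:
  fixes g :: "int \<Rightarrow> real" and H :: "nat \<Rightarrow> real"
  assumes g: "\<And>u. \<bar>g u\<bar> \<le> C / (1 + \<bar>real_of_int u\<bar>)"
    and H: "\<And>t. \<bar>L - H t\<bar> \<le> D / (real t + 1)"
    and G: "(\<lambda>M. \<Sum>u\<in>{- int M..<int M}. g u) \<longlonglongrightarrow> G"
  shows "(\<lambda>M. \<Sum>u\<in>{- int M..<int M}. g u * H (nat (int M - u))) \<longlonglongrightarrow> G * L"
proof -
  have "(\<lambda>M. \<Sum>u\<in>{- int M..<int M}. g u * (L - H (nat (int M - u)))) \<longlonglongrightarrow> 0"
  proof (rule Lim_null_comparison)
    show "(\<lambda>M. C * D * (\<Sum>u\<in>{- int M..<int M}. 1 / ((1 + \<bar>real_of_int u\<bar>) * (1 + (real M - real_of_int u))))) \<longlonglongrightarrow> 0"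
      using tendsto_mult_left[OF convolution_kernel_tendsto_0, of "C * D"] by simp
    have "norm (\<Sum>u\<in>{- int M..<int M}. g u * (L - H (nat (int M - u))))
        \<le> C * D * (\<Sum>u\<in>{- int M..<int M}. 1 / ((1 + \<bar>real_of_int u\<bar>) * (1 + (real M - real_of_int u))))" for M
      unfolding sum_distrib_left
    proof (intro sum_norm_le)
      fix u assume "u \<in> {- int M..<int M}"
      then have "\<bar>L - H (nat (int M - u))\<bar> \<le> D / (1 + (real M - real_of_int u))"
        using H[of "nat (int M - u)"] by (simp add: add.commute)
      then have "\<bar>g u\<bar> * \<bar>L - H (nat (int M - u))\<bar>
          \<le> (C / (1 + \<bar>real_of_int u\<bar>)) * (D / (1 + (real M - real_of_int u)))"
        using g[of u] by (intro mult_mono) (auto intro: order_trans[OF abs_ge_zero])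
      then show "norm (g u * (L - H (nat (int M - u))))
          \<le> C * D * (1 / ((1 + \<bar>real_of_int u\<bar>) * (1 + (real M - real_of_int u))))"
        by (simp add: abs_mult)
    qed
    then show "\<forall>\<^sub>F M in sequentially. norm (\<Sum>u\<in>{- int M..<int M}. g u * (L - H (nat (int M - u))))
        \<le> C * D * (\<Sum>u\<in>{- int M..<int M}. 1 / ((1 + \<bar>real_of_int u\<bar>) * (1 + (real M - real_of_int u))))"
      by simp
  qed
  from tendsto_diff[OF tendsto_mult_right[OF G, of L] this]
  show ?thesis
    by (simp add: sum_distrib_right right_diff_distrib sum_subtractf)
qed

subsection \<open>Lerch series and bilateral series\<close>

lemma sign_powi:
  fixes c :: real
  assumes "c \<in> {1, - 1}"
  shows "c powi u = (if even u then 1 else c)"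
  using assms by (auto simp: power_int_minus_left)

lemma sign_power:
  fixes c :: real
  assumes "c \<in> {1, - 1}"
  shows "c ^ m = (if even m then 1 else c)"
  using assms by (auto simp: uminus_power_if)

text \<open>For \<open>c = 1\<close> the exponent is at least 2 and the tail is compared with a
  telescoping series; for \<open>c = - 1\<close> the Leibniz criterion bounds the error by the first
  omitted term. Either way the error is \<open>O(1 / t)\<close>, the rate that the convolution lemma
  asks for.\<close>

lemma lerch_Phi_tail:
  assumes c: "c \<in> {1, - 1}" and \<alpha>: "\<alpha> > 0" and r: "r \<ge> 1" "c = 1 \<Longrightarrow> r \<noteq> 1"
  obtains D where "\<And>t. \<bar>lerch_Phi c r \<alpha> - (\<Sum>m<t. c ^ m / (real m + \<alpha>) ^ r)\<bar> \<le> D / (real t + 1)"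
    and "(\<lambda>m. c ^ m / (real m + \<alpha>) ^ r) sums lerch_Phi c r \<alpha>"
proof -
  define f where "f m = 1 / (real m + \<alpha>) ^ r" for m :: nat
  \<comment> \<open>Chosen so that \<open>\<mu> * (m + 1) \<le> m + \<alpha>\<close>, which reduces
    every estimate to \<open>\<alpha> = 1\<close> up to a constant.\<close>
  define \<mu> where "\<mu> = min \<alpha> 1"
  have \<mu>: "\<mu> > 0" using \<alpha> by (simp add: \<mu>_def)
  have Phi: "lerch_Phi c r \<alpha> = (\<Sum>m. c ^ m * f m)"
    using r by (simp add: lerch_Phi_def f_def)
  have f_le: "f m \<le> (1 / \<mu> ^ r) / (real m + 1) ^ r" for m
  proof -
    have "\<mu> * (real m + 1) \<le> real m + \<alpha>"
      using mult_right_mono[of \<mu> 1 "real m"] by (auto simp: \<mu>_def algebra_simps)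
    then have "(\<mu> * (real m + 1)) ^ r \<le> (real m + \<alpha>) ^ r"
      using \<mu> by (intro power_mono) auto
    then show ?thesis
      unfolding f_def using \<mu> by (simp add: power_mult_distrib frac_le)
  qed
  have f_nonneg: "f m \<ge> 0" for m using \<alpha> by (simp add: f_def)
  have f_dec: "f m' \<le> f m" if "m \<le> m'" for m m'
    using that \<alpha> unfolding f_def by (intro divide_left_mono power_mono) auto
  have f_le1: "f m \<le> (1 / \<mu> ^ r) / (real m + 1)" for m
    using \<mu> r by (intro order_trans[OF f_le] divide_left_mono self_le_power) auto
  have "\<exists>D. (\<forall>t. \<bar>(\<Sum>m. c ^ m * f m) - (\<Sum>m<t. c ^ m * f m)\<bar> \<le> D / (real t + 1)) \<and> summable (\<lambda>m. c ^ m * f m)"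
  proof (cases "c = 1")
    case True
    then have r2: "r \<ge> 2" using r by linarith
    \<comment> \<open>The factor 2 comes from
      \<open>(m + 1) * (m + 2) \<le> 2 * (m + 1) ^ 2\<close>, which makes the majorant
      telescope.\<close>
    define D where "D = 2 / \<mu> ^ r"
    have D: "D > 0" using \<mu> by (simp add: D_def)
    have f_le2: "f m \<le> D / (real m + 1) - D / (real (Suc m) + 1)" for m
    proof -
      have "f m \<le> (1 / \<mu> ^ r) / (real m + 1) ^ 2"
        using \<mu> r2 by (intro order_trans[OF f_le] divide_left_mono power_increasing) auto
      also have "\<dots> = D / (2 * (real m + 1) ^ 2)" by (simp add: D_def)
      also have "\<dots> \<le> D / ((real m + 1) * (real m + 2))"
        using D by (intro divide_left_mono mult_pos_pos zero_less_power) (auto simp: power2_eq_square algebra_simps)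
      also have "\<dots> = D / (real m + 1) - D / (real (Suc m) + 1)"
        by (simp add: divide_simps) (simp add: algebra_simps)
      finally show ?thesis .
    qed
    have tele: "(\<lambda>m. D / (real (m + t) + 1) - D / (real (Suc (m + t)) + 1)) sums (D / (real t + 1))" for t
    proof -
      have "(\<lambda>m. D / (real (m + t) + 1)) \<longlonglongrightarrow> 0" by real_asymp
      from telescope_sums'[OF this] show ?thesis by simp
    qed
    have sum_f: "summable f"
      by (rule summable_comparison_test'[of "\<lambda>m. D / (real (m + 0) + 1) - D / (real (Suc (m + 0)) + 1)" 0])
         (use f_le2 f_nonneg tele[of 0] sums_summable in auto)
    have "\<bar>suminf f - sum f {..<t}\<bar> \<le> D / (real t + 1)" for t
    proof -
      have "suminf f - sum f {..<t} = (\<Sum>m. f (m + t))"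
        using suminf_minus_initial_segment[OF sum_f] by simp
      moreover have "(\<Sum>m. f (m + t)) \<le> D / (real t + 1)"
        by (rule sums_le[OF _ summable_sums tele]) (rule f_le2, use sum_f in \<open>simp add: summable_iff_shift\<close>)
      moreover have "(\<Sum>m. f (m + t)) \<ge> 0"
        using sum_f f_nonneg by (intro suminf_nonneg) (auto simp: summable_iff_shift)
      ultimately show ?thesis by simp
    qed
    then show ?thesis using True sum_f by auto
  next
    case False
    then have c1: "c = - 1" using c by auto
    have "(\<lambda>m. (1 / \<mu> ^ r) / (real m + 1)) \<longlonglongrightarrow> 0" by real_asymp
    then have "f \<longlonglongrightarrow> 0"
      by (rule Lim_null_comparison[rotated]) (use f_le1 f_nonneg in auto)
    note L = summable_Leibniz'[OF this f_nonneg f_dec[OF le_SucI[OF order_refl]]]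
    \<comment> \<open>The limit lies between the partial sums of lengths \<open>t\<close> and
      \<open>t + 1\<close>, which differ by \<open>f t\<close>.\<close>
    have "\<bar>(\<Sum>m. (- 1) ^ m * f m) - (\<Sum>m<t. (- 1) ^ m * f m)\<bar> \<le> f t" for t
    proof (cases "even t")
      case True
      then obtain j where "t = 2 * j" by (elim evenE)
      then show ?thesis using L(2)[of j] L(4)[of j] by simp
    next
      case False
      then obtain j where "t = 2 * j + 1" by (elim oddE)
      then show ?thesis using L(2)[of "Suc j"] L(4)[of j] by simp
    qed
    then show ?thesis using f_le1 L(1) order_trans unfolding c1 by blast
  qed
  then show ?thesis
    using that unfolding Phi by (auto simp: f_def dest: summable_sums)
qed

lemma lerch_Phi_sums:
  assumes "c \<in> {1, - 1}" "\<alpha> > 0" "r \<ge> 1" "c = 1 \<Longrightarrow> r \<noteq> 1"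
  shows "(\<lambda>m. c ^ m / (real m + \<alpha>) ^ r) sums lerch_Phi c r \<alpha>"
  using lerch_Phi_tail[OF assms] by blast

text \<open>Away from a pole, \<open>u + \<sigma>\<close> is at least a constant multiple of
  \<open>1 + |u|\<close> in absolute value; at the pole the term is 0 because
  \<open>x / 0 = 0\<close>.\<close>

lemma bilateral_term_bound:
  assumes c: "c \<in> {1, - 1 :: real}" and \<sigma>: "0 \<le> \<sigma>" "\<sigma> < 1" and k: "k \<ge> 1"
  obtains C where "\<And>u. \<bar>c powi u / (real_of_int u + \<sigma>) ^ k\<bar> \<le> C / (1 + \<bar>real_of_int u\<bar>)"
proof -
  \<comment> \<open>A lower bound for \<open>|u + \<sigma>| / (1 + |u|)\<close>: this ratio is at
    least \<open>1 / 2\<close> for \<open>u \<ge> 1\<close>, \<open>\<sigma> = 0\<close>, at least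
    \<open>\<sigma>\<close> for \<open>u \<ge> 0\<close>, and at least
    \<open>(1 - \<sigma>) / 2\<close> for \<open>u \<le> - 1\<close>.\<close>
  define \<nu> where "\<nu> = min (if \<sigma> = 0 then 1 / 2 else \<sigma> / 2) ((1 - \<sigma>) / 2)"
  have \<nu>: "\<nu> > 0" "\<nu> \<le> (1 - \<sigma>) / 2" "\<sigma> = 0 \<Longrightarrow> \<nu> \<le> 1 / 2" "\<sigma> \<noteq> 0 \<Longrightarrow> \<nu> \<le> \<sigma> / 2"
    using \<sigma> by (auto simp: \<nu>_def min_def)
  have lower: "\<nu> * (1 + \<bar>real_of_int u\<bar>) \<le> \<bar>real_of_int u + \<sigma>\<bar>" if "real_of_int u + \<sigma> \<noteq> 0" for u
  proof (cases "u \<ge> 0")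
    case True
    show ?thesis
    proof (cases "\<sigma> = 0")
      case True
      have "\<nu> * (1 + \<bar>real_of_int u\<bar>) \<le> 1 / 2 * (1 + \<bar>real_of_int u\<bar>)"
        using \<nu> True by (intro mult_right_mono) auto
      moreover have "real_of_int u \<ge> 1" "\<bar>real_of_int u\<bar> = real_of_int u"
        using that True \<open>u \<ge> 0\<close> by simp_all
      moreover have "1 / 2 * (1 + x) \<le> x" if "x \<ge> 1" for x :: real
        using that by simp
      ultimately have "\<nu> * (1 + \<bar>real_of_int u\<bar>) \<le> \<bar>real_of_int u\<bar>"
        by (metis order_trans)
      then show ?thesis using True by simp
    next
      case False
      have "\<nu> * (1 + \<bar>real_of_int u\<bar>) \<le> \<sigma> * (1 + \<bar>real_of_int u\<bar>)"
        using \<nu>(4) False \<sigma> by (intro mult_right_mono) auto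
      also have "\<dots> \<le> \<sigma> + 1 * real_of_int u"
        using True \<sigma> mult_right_mono[of \<sigma> 1 "real_of_int u"] by (simp add: algebra_simps)
      finally show ?thesis using True \<sigma> by simp
    qed
  next
    case False
    then have u: "real_of_int u \<le> - 1" by simp
    have "\<nu> * (1 + \<bar>real_of_int u\<bar>) \<le> (1 - \<sigma>) / 2 * (1 + \<bar>real_of_int u\<bar>)"
      using \<nu> by (intro mult_right_mono) auto
    also have "\<dots> \<le> (1 - \<sigma>) / 2 * (- 2 * real_of_int u)"
      using u \<sigma> by (intro mult_left_mono) auto
    also have "\<dots> = - real_of_int u + \<sigma> * real_of_int u" by (simp add: field_simps)
    also have "\<dots> \<le> - real_of_int u + \<sigma> * (- 1)"
      using u \<sigma> by (intro add_left_mono mult_left_mono) auto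
    finally show ?thesis using u \<sigma> by simp
  qed
  have "\<bar>c powi u / (real_of_int u + \<sigma>) ^ k\<bar> \<le> (1 / \<nu> ^ k) / (1 + \<bar>real_of_int u\<bar>)" for u
  proof (cases "real_of_int u + \<sigma> = 0")
    case True
    then have "(real_of_int u + \<sigma>) ^ k = 0" using k by simp
    then have "\<bar>c powi u / (real_of_int u + \<sigma>) ^ k\<bar> = 0" by (simp only: div_by_0 abs_zero)
    then show ?thesis using \<nu> by (simp only:) simp
  next
    case False
    have "\<bar>c powi u / (real_of_int u + \<sigma>) ^ k\<bar> = 1 / \<bar>real_of_int u + \<sigma>\<bar> ^ k"
      using c by (auto simp: sign_powi power_abs)
    also have "\<dots> \<le> 1 / (\<nu> * (1 + \<bar>real_of_int u\<bar>)) ^ k"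
      using lower[OF False] \<nu> False by (intro divide_left_mono power_mono mult_pos_pos zero_less_power) auto
    also have "\<dots> = (1 / \<nu> ^ k) / (1 + \<bar>real_of_int u\<bar>) ^ k"
      by (simp add: power_mult_distrib)
    also have "\<dots> \<le> (1 / \<nu> ^ k) / (1 + \<bar>real_of_int u\<bar>)"
      using \<nu> k by (intro divide_left_mono self_le_power) auto
    finally show ?thesis .
  qed
  then show ?thesis using that by blast
qed

section \<open>The cotangent series\<close>

text \<open>The logarithmic derivative of Euler's reflection formula: both sides of
  \<open>Gamma w * Gamma (1 - w) = pi / sin (pi * w)\<close> are differentiated at \<open>z\<close>,
  and the nonzero common factor is cancelled.\<close>

lemma Digamma_reflection:
  fixes x :: real
  assumes "0 < x" "x < 1"
  shows "Digamma (of_real (1 - x) :: complex) - Digamma (of_real x) = of_real (pi * cot (pi * x))"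
proof -
  define z :: complex where "z = of_real x"
  have z: "z \<notin> \<int>\<^sub>\<le>\<^sub>0" "1 - z \<notin> \<int>\<^sub>\<le>\<^sub>0"
    using assms by (auto simp: z_def elim!: nonpos_Ints_cases simp: complex_eq_iff)
  have sin: "sin (of_real pi * z) \<noteq> 0"
    using assms sin_gt_zero[of "pi * x"]
    by (simp add: z_def sin_of_real flip: of_real_mult)
  have D1: "((\<lambda>w. Gamma w * Gamma (1 - w)) has_field_derivative
      Gamma z * Gamma (1 - z) * (Digamma z - Digamma (1 - z))) (at z)"
    using z by (auto intro!: derivative_eq_intros simp: algebra_simps)
  have D2: "((\<lambda>w. of_real pi / sin (of_real pi * w)) has_field_derivative
      - (of_real pi / sin (of_real pi * z)) * (of_real pi * cot (of_real pi * z))) (at z)"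
    using sin by (auto intro!: derivative_eq_intros simp: cot_def)
  have "Gamma w * Gamma (1 - w) = of_real pi / sin (of_real pi * w)" for w :: complex
    by (rule Gamma_reflection_complex)
  with D1 have "((\<lambda>w. of_real pi / sin (of_real pi * w)) has_field_derivative
      of_real pi / sin (of_real pi * z) * (Digamma z - Digamma (1 - z))) (at z)"
    by simp
  from DERIV_unique[OF this D2]
  have "of_real pi / sin (of_real pi * z) * (Digamma z - Digamma (1 - z))
      = of_real pi / sin (of_real pi * z) * (- (of_real pi * cot (of_real pi * z)))"
    by simp
  moreover have "of_real pi / sin (of_real pi * z) \<noteq> 0" using sin by simp
  ultimately have "Digamma z - Digamma (1 - z) = - (of_real pi * cot (of_real pi * z))"
    by (metis mult_left_cancel)
  then have "Digamma (1 - z) - Digamma z = of_real pi * cot (of_real pi * z)"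
    by (simp add: algebra_simps)
  then show ?thesis
    by (simp add: z_def cot_def sin_of_real cos_of_real flip: of_real_mult)
qed

text \<open>The symmetric window yields the difference of the series at \<open>x\<close> and at
  \<open>1 - x\<close>. Each diverges like \<open>ln M\<close>, and in the difference of the two
  limit formulas for \<open>Digamma\<close> the logarithms cancel.\<close>

lemma cot_partial_fractions:
  fixes x :: real
  assumes "0 < x" "x < 1"
  shows "(\<lambda>M. \<Sum>u\<in>{- int M..<int M}. 1 / (real_of_int u + x)) \<longlonglongrightarrow> pi * cot (pi * x)"
proof -
  have "(\<lambda>m. (of_real (ln (real m)) - (\<Sum>n<m. inverse (of_real (1 - x) + of_nat n)))
            - (of_real (ln (real m)) - (\<Sum>n<m. inverse (of_real x + of_nat n))))
     \<longlonglongrightarrow> (Digamma (of_real (1 - x)) - Digamma (of_real x) :: complex)"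
    using assms by (intro tendsto_diff Digamma_LIMSEQ) auto
  also have "(\<lambda>m. (of_real (ln (real m)) - (\<Sum>n<m. inverse (of_real (1 - x) + of_nat n)))
            - (of_real (ln (real m)) - (\<Sum>n<m. inverse (of_real x + of_nat n))))
      = (\<lambda>M. of_real (\<Sum>u\<in>{- int M..<int M}. 1 / (real_of_int u + x)) :: complex)"
  proof
    fix M
    have "(\<Sum>u\<in>{- int M..<int M}. 1 / (real_of_int u + x))
        = (\<Sum>n<M. inverse (x + real n)) - (\<Sum>n<M. inverse (1 - x + real n))"
    proof -
      have "(\<Sum>v<M. 1 / (real_of_int (- 1 - int v) + x)) = (\<Sum>n<M. - inverse (1 - x + real n))"
        using assms by (intro sum.cong refl) (auto simp: divide_simps)
      then show ?thesis
        unfolding sum_symmetric_int by (simp add: sum_negf inverse_eq_divide add.commute)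
    qed
    then show "(of_real (ln (real M)) - (\<Sum>n<M. inverse (of_real (1 - x) + of_nat n)))
            - (of_real (ln (real M)) - (\<Sum>n<M. inverse (of_real x + of_nat n)))
      = (of_real (\<Sum>u\<in>{- int M..<int M}. 1 / (real_of_int u + x)) :: complex)"
      by simp
  qed
  finally show ?thesis
    unfolding Digamma_reflection[OF assms] by (simp only: tendsto_of_real_iff)
qed

text \<open>The half \<open>u = - 1 - v\<close> contributes \<open>c * (- 1) ^ k\<close> times the
  Lerch series at \<open>(r - s) / r\<close>. For \<open>c = k = 1\<close> the two halves diverge
  separately and only the cotangent series remains.\<close>

lemma bilateral_tendsto_Theta:
  assumes c: "c \<in> {1, - 1}" and k: "k \<ge> 1" and s: "0 < s" "s < r"
  shows "(\<lambda>M. \<Sum>u\<in>{- int M..<int M}. c powi u / (real_of_int u + s / r) ^ k) \<longlonglongrightarrow> lerch_Theta c k s r"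
proof (cases "c = 1 \<and> k = 1")
  case True
  then show ?thesis
    using cot_partial_fractions[of "s / r"] s by (simp add: lerch_Theta_def)
next
  case False
  have eq: "(r - s) / r = 1 - s / r" using s by (simp add: field_simps)
  have pos: "s / r > 0" "(r - s) / r > 0" using s by auto
  have ck: "c = 1 \<Longrightarrow> k \<noteq> 1" using False by auto
  have "(\<lambda>M. (\<Sum>u<M. c ^ u / (real u + s / r) ^ k) + c * (- 1) ^ k * (\<Sum>v<M. c ^ v / (real v + (r - s) / r) ^ k))
      \<longlonglongrightarrow> lerch_Theta c k s r"
    using False lerch_Phi_sums[OF c pos(1) k ck] lerch_Phi_sums[OF c pos(2) k ck]
    unfolding lerch_Theta_def sums_def by (auto intro!: tendsto_intros)
  moreover have "(\<Sum>u\<in>{- int M..<int M}. c powi u / (real_of_int u + s / r) ^ k)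
      = (\<Sum>u<M. c ^ u / (real u + s / r) ^ k) + c * (- 1) ^ k * (\<Sum>v<M. c ^ v / (real v + (r - s) / r) ^ k)" for M
  proof -
    have "c powi (- 1 - int v) / (real_of_int (- 1 - int v) + s / r) ^ k
        = c * (- 1) ^ k * (c ^ v / (real v + (r - s) / r) ^ k)" for v
    proof -
      have "real_of_int (- 1 - int v) + s / r = - (real v + (r - s) / r)" unfolding eq by simp
      moreover have "c powi (- 1 - int v) = c * c ^ v"
        using c by (auto simp: sign_powi sign_power)
      ultimately show ?thesis by (simp only: power_minus[of "real v + (r - s) / r"]) (simp add: uminus_power_if)
    qed
    then show ?thesis unfolding sum_symmetric_int sum_distrib_left by simp
  qed
  ultimately show ?thesis by simp
qed

text \<open>The pole \<open>u = 0\<close> drops out and the two halves agree up to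
  \<open>(- 1) ^ k\<close>. The window is one longer on the negative side; that unpaired boundary
  term tends to 0.\<close>

lemma bilateral_tendsto_0:
  assumes c: "c \<in> {1, - 1}" and k: "k \<ge> 1"
  shows "(\<lambda>M. \<Sum>u\<in>{- int M..<int M}. c powi u / real_of_int u ^ k) \<longlonglongrightarrow> c * (1 + (- 1) ^ k) * lerch_Phi c k 1"
proof -
  have eq: "(\<Sum>u\<in>{- int (Suc M)..<int (Suc M)}. c powi u / real_of_int u ^ k)
      = c * (1 + (- 1) ^ k) * (\<Sum>v<M. c ^ v / (real v + 1) ^ k) + c * (- 1) ^ k * (c ^ M / (real M + 1) ^ k)" for M
  proof -
    have 1: "c powi (- 1 - int v) / real_of_int (- 1 - int v) ^ k = c * (- 1) ^ k * (c ^ v / (real v + 1) ^ k)" for v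
    proof -
      have "real_of_int (- 1 - int v) = - (real v + 1)" by simp
      moreover have "c powi (- 1 - int v) = c * c ^ v"
        using c by (auto simp: sign_powi sign_power)
      ultimately show ?thesis by (simp only: power_minus[of "real v + 1"]) (simp add: uminus_power_if)
    qed
    have "(\<Sum>u<Suc M. c powi int u / real_of_int (int u) ^ k) = c * (\<Sum>v<M. c ^ v / (real v + 1) ^ k)"
    proof -
      have "c powi int (Suc v) / real_of_int (int (Suc v)) ^ k = c * (c ^ v / (real v + 1) ^ k)" for v
      proof -
        have "real_of_int (int (Suc v)) = real v + 1" by simp
        moreover have "c powi int (Suc v) = c * c ^ v" by (subst power_int_of_nat) simp
        ultimately show ?thesis by (simp only: times_divide_eq_right)
      qed
      then show ?thesis
        using k unfolding sum_distrib_left by (subst sum.lessThan_Suc_shift) (simp only:, simp)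
    qed
    moreover have "(\<Sum>v<Suc M. c * (- 1) ^ k * (c ^ v / (real v + 1) ^ k))
        = c * (- 1) ^ k * (\<Sum>v<M. c ^ v / (real v + 1) ^ k) + c * (- 1) ^ k * (c ^ M / (real M + 1) ^ k)"
      by (simp add: sum_distrib_left)
    ultimately show ?thesis
      unfolding sum_symmetric_int 1 by (simp only: distrib_left distrib_right mult_1_right add.assoc)
  qed
  have lim0: "(\<lambda>M. c ^ M / (real M + 1) ^ k) \<longlonglongrightarrow> 0"
  proof (rule Lim_null_comparison)
    show "(\<lambda>M. 1 / (real M + 1)) \<longlonglongrightarrow> 0" by real_asymp
    show "\<forall>\<^sub>F M in sequentially. norm (c ^ M / (real M + 1) ^ k) \<le> 1 / (real M + 1)"
      using c k by (intro always_eventually allI)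
        (auto simp: sign_power abs_mult intro!: divide_left_mono self_le_power)
  qed
  have "(\<lambda>M. c * (1 + (- 1) ^ k) * (\<Sum>v<M. c ^ v / (real v + 1) ^ k)) \<longlonglongrightarrow> c * (1 + (- 1) ^ k) * lerch_Phi c k 1"
  \<comment> \<open>For \<open>k = 1\<close> the factor \<open>1 + (- 1) ^ k\<close> is 0, so
    convergence of the one-sided series is only invoked where it holds.\<close>
  proof (cases "k = 1")
    case False
    then show ?thesis
      using lerch_Phi_sums[OF c zero_less_one k] unfolding sums_def by (auto intro!: tendsto_intros)
  qed simp
  from tendsto_add[OF this tendsto_mult_left[OF lim0, of "c * (- 1) ^ k"]]
  show ?thesis
    by (subst filterlim_sequentially_Suc[symmetric]) (simp only: eq, simp)
qed

subsection \<open>The cone and the half plane\<close>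

text \<open>Terms with \<open>m = 0\<close> or \<open>N = 0\<close> vanish because \<open>x / 0 = 0\<close>.\<close>

definition lattice_term :: "real \<Rightarrow> real \<Rightarrow> nat \<Rightarrow> nat \<Rightarrow> int \<Rightarrow> int \<Rightarrow> real" where
  "lattice_term a b p q m N = b powi m * a powi N / (real_of_int m ^ p * real_of_int N ^ q)"

text \<open>The height \<open>n * M\<close> of the box is matched to the slope of the line
  \<open>N = n m\<close>, which then leaves the box at its corner.\<close>

definition cone_sum :: "real \<Rightarrow> real \<Rightarrow> nat \<Rightarrow> nat \<Rightarrow> nat \<Rightarrow> nat \<Rightarrow> real" where
  "cone_sum a b p q n M = (\<Sum>m=1..M. \<Sum>N=1..n * M. if N > n * m then lattice_term a b p q (int m) (int N) else 0)"

definition half_plane_sum :: "real \<Rightarrow> real \<Rightarrow> nat \<Rightarrow> nat \<Rightarrow> nat \<Rightarrow> nat \<Rightarrow> real" where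
  "half_plane_sum a b p q n M = (\<Sum>m\<in>{- int M..int M}. \<Sum>N\<in>{- int (n * M)..int (n * M)}.
     if N < int n * m then lattice_term a b p q m N else 0)"

lemma sum_int_fold:
  fixes f :: "int \<Rightarrow> 'a::comm_monoid_add"
  shows "(\<Sum>u\<in>{- int M..int M}. f u) = f 0 + (\<Sum>m=1..M. f (int m) + f (- int m))"
proof (induction M)
  case (Suc M)
  have "{- int (Suc M)..int (Suc M)} = insert (int (Suc M)) (insert (- int (Suc M)) {- int M..int M})"
    by auto
  then show ?case using Suc by (simp add: ac_simps)
qed simp

text \<open>Each positive integer up to \<open>n * t\<close> is \<open>n * e - s\<close> for exactly
  one \<open>e\<close> and residue \<open>s\<close>; this later merges the residues into one
  series.\<close>

lemma sum_blocks:
  fixes f :: "nat \<Rightarrow> 'a::comm_monoid_add"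
  shows "(\<Sum>e=1..t. \<Sum>s<n. f (n * e - s)) = (\<Sum>D=1..n * t. f D)"
proof (induction t)
  case (Suc t)
  have "(\<Sum>s<n. f (n * Suc t - s)) = (\<Sum>D=n * t + 1..n * t + n. f D)"
    by (rule sum.reindex_bij_witness[of _ "\<lambda>D. n * Suc t - D" "\<lambda>s. n * Suc t - s"]) auto
  then show ?case
    using Suc sum.ub_add_nat[of 1 "n * t" f n] by (simp add: add.commute)
qed simp

lemma lattice_term_reflect:
  assumes "a \<in> {1, - 1}" "b \<in> {1, - 1}"
  shows "lattice_term a b p q m (- N) = (- 1) ^ q * lattice_term a b p q m N"
    and "odd (p + q) \<Longrightarrow> lattice_term a b p q (- m) (- N) = - lattice_term a b p q m N"
  using assms by (auto simp: lattice_term_def sign_powi uminus_power_if)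

text \<open>Fold the four sign quadrants onto \<open>m, N > 0\<close>. The half plane receives the
  points below the diagonal, all points with sign \<open>(- 1) ^ q\<close> from
  \<open>(m, - N)\<close>, none from \<open>(- m, N)\<close>, and the cone with sign -1 from
  \<open>(- m, - N)\<close>. Since below = all - diagonal - cone, the half plane equals
  \<open>(1 + (- 1) ^ q)\<close> all - diagonal - 2 cone.\<close>

lemma cone_half_plane_decomposition:
  assumes ab: "a \<in> {1, - 1}" "b \<in> {1, - 1}" and pq: "p \<ge> 1" "q \<ge> 1" "odd (p + q)" and n: "n \<ge> 1"
  shows "2 * cone_sum a b p q n M =
      (1 + (- 1) ^ q) * ((\<Sum>m=1..M. b ^ m / real m ^ p) * (\<Sum>N=1..n * M. a ^ N / real N ^ q))
    - (\<Sum>m=1..M. (a ^ n * b) ^ m / real m ^ (p + q)) / real n ^ q - half_plane_sum a b p q n M"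
proof -
  let ?X = "lattice_term a b p q"
  have prod: "(\<Sum>m=1..M. b ^ m / real m ^ p) * (\<Sum>N=1..n * M. a ^ N / real N ^ q)
      = (\<Sum>m=1..M. \<Sum>N=1..n * M. ?X (int m) (int N))"
    by (simp add: sum_product lattice_term_def)
  have diag: "(\<Sum>m=1..M. (a ^ n * b) ^ m / real m ^ (p + q)) / real n ^ q
      = (\<Sum>m=1..M. \<Sum>N=1..n * M. if N = n * m then ?X (int m) (int N) else 0)"
    unfolding sum_divide_distrib
  proof (intro sum.cong refl)
    fix m assume m: "m \<in> {1..M}"
    then have "n * m \<in> {1..n * M}" using n by auto
    then have "(\<Sum>N=1..n * M. if N = n * m then ?X (int m) (int N) else 0) = ?X (int m) (int (n * m))"
      by (subst sum.delta) auto
    also have "\<dots> = (a ^ n * b) ^ m / real m ^ (p + q) / real n ^ q"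
    proof -
      have "?X (int m) (int (n * m)) = b ^ m * a ^ (n * m) / (real m ^ p * (real n * real m) ^ q)"
        by (simp add: lattice_term_def power_int_of_nat flip: of_nat_mult)
      also have "\<dots> = (b ^ m * (a ^ n) ^ m) / (real m ^ p * (real n ^ q * real m ^ q))"
        by (simp only: power_mult power_mult_distrib)
      also have "\<dots> = (a ^ n * b) ^ m / real m ^ (p + q) / real n ^ q"
        by (simp only: power_mult_distrib power_add divide_divide_eq_left ac_simps)
      finally show ?thesis .
    qed
    finally show "(a ^ n * b) ^ m / real m ^ (p + q) / real n ^ q
        = (\<Sum>N=1..n * M. if N = n * m then ?X (int m) (int N) else 0)" ..
  qed
  have zero: "?X 0 N = 0" "?X m 0 = 0" for m N
    using pq by (simp_all add: lattice_term_def)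
  have zero': "(if P then ?X 0 N else 0) = 0" "(if P then ?X m 0 else 0) = 0" for m N P
    by (simp_all add: zero)
  have half: "half_plane_sum a b p q n M = (\<Sum>m=1..M. \<Sum>N=1..n * M.
      (if N < n * m then ?X (int m) (int N) else 0) + (- 1) ^ q * ?X (int m) (int N)
      - (if N > n * m then ?X (int m) (int N) else 0))"
    unfolding half_plane_sum_def sum_int_fold zero' sum.neutral_const add_0 sum.distrib[symmetric]
  proof (intro sum.cong refl)
    fix m N assume "m \<in> {1..M}" "N \<in> {1..n * M}"
    then have mN: "m \<ge> 1" "N \<ge> 1" by auto
    have 1: "int N < int n * int m \<longleftrightarrow> N < n * m" by (simp flip: of_nat_mult)
    have 2: "- int N < int n * int m" using mN by (smt (verit) of_nat_0_le_iff mult_nonneg_nonneg of_nat_1 of_nat_mono)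
    have 3: "\<not> int N < int n * - int m" using mN by (smt (verit) of_nat_0_le_iff mult_nonneg_nonneg mult_minus_right)
    have 4: "- int N < int n * - int m \<longleftrightarrow> N > n * m" by (simp flip: of_nat_mult)
    show "(if int N < int n * int m then ?X (int m) (int N) else 0)
        + (if - int N < int n * int m then ?X (int m) (- int N) else 0)
        + ((if int N < int n * - int m then ?X (- int m) (int N) else 0)
        + (if - int N < int n * - int m then ?X (- int m) (- int N) else 0))
      = (if N < n * m then ?X (int m) (int N) else 0) + (- 1) ^ q * ?X (int m) (int N)
        - (if N > n * m then ?X (int m) (int N) else 0)"
      unfolding 1 4 using 2 3 lattice_term_reflect[OF ab] pq by simp
  qed
  show ?thesis
    unfolding prod diag half cone_sum_def unfolding sum_distrib_left sum_subtractf[symmetric]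
    by (intro sum.cong refl) (auto simp: algebra_simps)
qed

text \<open>With \<open>N = n k + j\<close>, \<open>1 \<le> j \<le> n\<close>, the condition
  \<open>N > n m\<close> says \<open>m \<le> k\<close>, which produces the harmonic number. The
  factor \<open>a * b\<close> accounts for the exponents \<open>j - 1\<close> and
  \<open>m - 1\<close>.\<close>

lemma cone_sum_eq_partial_sum:
  assumes ab: "a \<in> {1, - 1}" "b \<in> {1, - 1}"
  shows "(\<Sum>i<M. let k = Suc i in (a ^ n) ^ k * gen_harm p b k
          * (\<Sum>j=1..n. a ^ (j - 1) / (real n * real k + real j) ^ q)) = a * b * cone_sum a b p q n (Suc M)"
proof -
  let ?X = "lattice_term a b p q"
  \<comment> \<open>Enlarging the box adds the rows \<open>n * k < N \<le> n * k + n\<close>, which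
    lie in the cone for every \<open>m \<le> k\<close>; the new column \<open>m = Suc k\<close> is
    empty.\<close>
  have step: "cone_sum a b p q n (Suc k) = cone_sum a b p q n k + (\<Sum>m=1..k. \<Sum>j=1..n. ?X (int m) (int (n * k + j)))" for k
  proof -
    have "cone_sum a b p q n (Suc k)
        = (\<Sum>m=1..k. \<Sum>N=1..n * k + n. if N > n * m then ?X (int m) (int N) else 0)"
      unfolding cone_sum_def by (subst sum.nat_ivl_Suc') (auto intro!: sum.neutral simp: add.commute)
    also have "\<dots> = (\<Sum>m=1..k. (\<Sum>N=1..n * k. if N > n * m then ?X (int m) (int N) else 0)
        + (\<Sum>j=1..n. ?X (int m) (int (n * k + j))))"
    proof (intro sum.cong refl)
      fix m assume m: "m \<in> {1..k}"
      then have le: "n * m \<le> n * k" by simp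
      have "(\<Sum>N=n * k + 1..n * k + n. if N > n * m then ?X (int m) (int N) else 0)
          = (\<Sum>N=n * k + 1..n * k + n. ?X (int m) (int N))"
      proof (intro sum.cong refl)
        fix N assume "N \<in> {n * k + 1..n * k + n}"
        then have "N > n * m" using le unfolding atLeastAtMost_iff by linarith
        then show "(if N > n * m then ?X (int m) (int N) else 0) = ?X (int m) (int N)" by simp
      qed
      also have "\<dots> = (\<Sum>j=1..n. ?X (int m) (int (n * k + j)))"
        by (intro sum.reindex_bij_witness[of _ "\<lambda>j. n * k + j" "\<lambda>N. N - n * k"]) auto
      finally show "(\<Sum>N=1..n * k + n. if N > n * m then ?X (int m) (int N) else 0)
          = (\<Sum>N=1..n * k. if N > n * m then ?X (int m) (int N) else 0) + (\<Sum>j=1..n. ?X (int m) (int (n * k + j)))"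
        by (subst sum.ub_add_nat) auto
    qed
    finally show ?thesis unfolding cone_sum_def sum.distrib .
  qed
  have aa: "a * a = 1" "b * b = 1" using ab by auto
  have summand: "(a ^ n) ^ k * gen_harm p b k * (\<Sum>j=1..n. a ^ (j - 1) / (real n * real k + real j) ^ q)
      = a * b * (\<Sum>m=1..k. \<Sum>j=1..n. ?X (int m) (int (n * k + j)))" for k
    unfolding gen_harm_def mult.assoc[of "(a ^ n) ^ k"] sum_product
    unfolding sum_distrib_left
  proof (intro sum.cong refl)
    fix m j assume "m \<in> {1..k}" "j \<in> {1..n}"
    then obtain m' j' where [simp]: "m = Suc m'" "j = Suc j'"
      by (metis atLeastAtMost_iff not0_implies_Suc not_one_le_zero)
    have "a * b * ?X (int m) (int (n * k + j))
        = a * b * (b ^ m * a ^ (n * k + j) / (real m ^ p * real (n * k + j) ^ q))"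
      unfolding lattice_term_def power_int_of_nat by simp
    also have "\<dots> = (a * a) * (b * b) * ((a ^ n) ^ k * (b ^ m' / real m ^ p * (a ^ j' / (real n * real k + real j) ^ q)))"
      by (simp add: power_add power_mult) (simp add: ac_simps)
    finally show "(a ^ n) ^ k * (b ^ (m - 1) / real m ^ p * (a ^ (j - 1) / (real n * real k + real j) ^ q))
        = a * b * ?X (int m) (int (n * k + j))"
      unfolding aa by simp
  qed
  show ?thesis
  proof (induction M)
    case 0
    show ?case by (simp add: cone_sum_def)
  next
    case (Suc M)
    then show ?case
      unfolding sum.lessThan_Suc Let_def summand step[of "Suc M"] by (simp add: distrib_left)
  qed
qed

text \<open>Division with remainder: \<open>N < n m\<close> means \<open>N div n < m\<close>, that
  is \<open>e \<ge> 1\<close>. The box becomes the triangle \<open>- M \<le> u < M\<close>,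
  \<open>u + e \<le> M\<close>; the bounds \<open>N \<le> n M\<close> and \<open>m \<ge> - M\<close>
  are then automatic.\<close>

lemma half_plane_sum_residues:
  assumes n: "n \<ge> 1"
  shows "half_plane_sum a b p q n M = (\<Sum>s<n. \<Sum>u\<in>{- int M..<int M}. \<Sum>e=1..nat (int M - u).
      lattice_term a b p q (u + int e) (int n * u + int s))"
proof -
  let ?X = "lattice_term a b p q"
  let ?I = "SIGMA m:{- int M..int M}. {N\<in>{- int (n * M)..int (n * M)}. N < int n * m}"
  let ?J = "SIGMA s:{..<n}. SIGMA u:{- int M..<int M}. {1..nat (int M - u)}"
  have n': "int n > 0" using n by simp
  have fin: "finite {N\<in>{- int (n * M)..int (n * M)}. N < int n * m}" for m
    by (rule finite_subset[of _ "{- int (n * M)..int (n * M)}"]) auto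
  have "half_plane_sum a b p q n M
      = (\<Sum>m\<in>{- int M..int M}. \<Sum>N\<in>{N\<in>{- int (n * M)..int (n * M)}. N < int n * m}. ?X m N)"
    unfolding half_plane_sum_def by (intro sum.cong refl sum.inter_filter[symmetric]) simp
  also have "\<dots> = (\<Sum>(m, N)\<in>?I. ?X m N)"
    by (rule sum.Sigma) (simp, intro ballI fin)
  also have "\<dots> = (\<Sum>(s, u, e)\<in>?J. ?X (u + int e) (int n * u + int s))"
  proof (rule sum.reindex_bij_witness[of _ "\<lambda>(s, u, e). (u + int e, int n * u + int s)"
        "\<lambda>(m, N). (nat (N mod int n), N div int n, nat (m - N div int n))"])
    fix x assume "x \<in> ?I"
    then obtain m N where x: "x = (m, N)" and m: "- int M \<le> m" "m \<le> int M"
      and N: "- (int n * int M) \<le> N" "N < int n * m"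
      by auto
    have lt: "N div int n < m"
    proof (rule ccontr)
      assume "\<not> N div int n < m"
      then have "int n * m \<le> int n * (N div int n)" by (intro mult_left_mono) auto
      also have "\<dots> \<le> N" using n' by (simp add: minus_mod_eq_mult_div[symmetric])
      finally show False using N by simp
    qed
    have ge: "- int M \<le> N div int n"
    proof -
      have "int n * (- int M) div int n = - int M"
        using n' by (intro nonzero_mult_div_cancel_left) auto
      moreover have "int n * (- int M) div int n \<le> N div int n"
        using N n' by (intro zdiv_mono1) auto
      ultimately show ?thesis by simp
    qed
    have md: "0 \<le> N mod int n" "N mod int n < int n" using n' by auto
    show "(case (case x of (m, N) \<Rightarrow> (nat (N mod int n), N div int n, nat (m - N div int n))) of
        (s, u, e) \<Rightarrow> (u + int e, int n * u + int s)) = x"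
      using lt md by (simp add: x)
    show "(case x of (m, N) \<Rightarrow> (nat (N mod int n), N div int n, nat (m - N div int n))) \<in> ?J"
      using lt ge md m by (auto simp: x nat_less_iff)
    show "(case (case x of (m, N) \<Rightarrow> (nat (N mod int n), N div int n, nat (m - N div int n))) of
        (s, u, e) \<Rightarrow> ?X (u + int e) (int n * u + int s)) = (case x of (m, N) \<Rightarrow> ?X m N)"
      using lt md by (simp add: x)
  next
    fix x assume "x \<in> ?J"
    then obtain s u e where x: "x = (s, u, e)" and s: "s < n" and u: "- int M \<le> u" "u < int M"
      and e: "e \<ge> 1" "int e \<le> int M - u"
      by auto
    have dm: "(int n * u + int s) div int n = u" "(int n * u + int s) mod int n = int s"
      using s by simp_all
    have "int n * u + int s < int n * (u + 1)" using s by (simp add: distrib_left)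
    also have "\<dots> \<le> int n * (u + int e)" using e by (intro mult_left_mono) auto
    finally have lt: "int n * u + int s < int n * (u + int e)" .
    moreover have "int n * (u + int e) \<le> int n * int M" using e by (intro mult_left_mono) auto
    moreover have "int n * (- int M) \<le> int n * u" using u by (intro mult_left_mono) auto
    ultimately show "(case x of (s, u, e) \<Rightarrow> (u + int e, int n * u + int s)) \<in> ?I"
      using u e by (auto simp: x)
    show "(case (case x of (s, u, e) \<Rightarrow> (u + int e, int n * u + int s)) of
        (m, N) \<Rightarrow> (nat (N mod int n), N div int n, nat (m - N div int n))) = x"
      using s by (simp add: x)
  qed
  also have "\<dots> = (\<Sum>s<n. \<Sum>u\<in>{- int M..<int M}. \<Sum>e=1..nat (int M - u). ?X (u + int e) (int n * u + int s))"
    by (simp add: sum.Sigma)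
  finally show ?thesis .
qed

subsection \<open>The limit of the half plane sum\<close>

text \<open>The limit of the bilateral series with shift \<open>s / n\<close>. For
  \<open>s = 0\<close> the shift meets the pole, which is outside the domain of
  \<open>lerch_Theta\<close>.\<close>

definition bilateral_value :: "real \<Rightarrow> nat \<Rightarrow> nat \<Rightarrow> nat \<Rightarrow> real" where
  "bilateral_value c k s n =
     (if s = 0 then c * (1 + (- 1) ^ k) * lerch_Phi c k 1 else lerch_Theta c k (real s) (real n))"

lemma bilateral_tendsto:
  assumes "c \<in> {1, - 1}" "k \<ge> 1" "s < n"
  shows "(\<lambda>M. \<Sum>u\<in>{- int M..<int M}. c powi u / (real_of_int u + real s / real n) ^ k) \<longlonglongrightarrow> bilateral_value c k s n"
  using bilateral_tendsto_0[of c k] bilateral_tendsto_Theta[of c k "real s" "real n"] assms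
  by (auto simp: bilateral_value_def)

text \<open>The index shift \<open>e = m + 1\<close> produces both the factor \<open>c\<close> and
  the argument \<open>1 - \<sigma>\<close>.\<close>

lemma shifted_partial_sum_tail:
  assumes c: "c \<in> {1, - 1}" and \<sigma>: "\<sigma> < 1" and r: "r \<ge> 1" "c = 1 \<Longrightarrow> r \<noteq> 1"
  obtains D where "\<And>t. \<bar>c * lerch_Phi c r (1 - \<sigma>) - (\<Sum>e=1..t. c ^ e / (real e - \<sigma>) ^ r)\<bar> \<le> D / (real t + 1)"
proof -
  obtain D where D: "\<And>t. \<bar>lerch_Phi c r (1 - \<sigma>) - (\<Sum>m<t. c ^ m / (real m + (1 - \<sigma>)) ^ r)\<bar> \<le> D / (real t + 1)"
    using lerch_Phi_tail[of c "1 - \<sigma>" r] assms by auto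
  have "(\<Sum>e=1..t. c ^ e / (real e - \<sigma>) ^ r) = c * (\<Sum>m<t. c ^ m / (real m + (1 - \<sigma>)) ^ r)" for t
    unfolding sum_distrib_left
    by (rule sum.reindex_bij_witness[of _ Suc "\<lambda>e. e - 1"]) (auto simp: algebra_simps simp flip: power_Suc)
  then have "\<bar>c * lerch_Phi c r (1 - \<sigma>) - (\<Sum>e=1..t. c ^ e / (real e - \<sigma>) ^ r)\<bar>
      = \<bar>lerch_Phi c r (1 - \<sigma>) - (\<Sum>m<t. c ^ m / (real m + (1 - \<sigma>)) ^ r)\<bar>" for t
    using c by (auto simp: abs_minus_commute)
  with D that show ?thesis by metis
qed

text \<open>Since \<open>e - s / n = (n * e - s) / n\<close>, the double sum is \<open>n ^ r\<close>
  times a single partial sum of length \<open>n * t \<ge> t\<close>, so the tail bound carries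
  over.\<close>

lemma block_partial_sum_tail:
  assumes a: "a \<in> {1, - 1}" and n: "n \<ge> 1" and r: "r \<ge> 1" "a = 1 \<Longrightarrow> r \<noteq> 1"
  obtains D where "\<And>t. \<bar>real n ^ r * (a * lerch_Phi a r 1)
      - (\<Sum>e=1..t. \<Sum>s<n. a ^ (n * e - s) / (real e - real s / real n) ^ r)\<bar> \<le> D / (real t + 1)"
proof -
  obtain D where D: "\<And>t. \<bar>a * lerch_Phi a r (1 - 0) - (\<Sum>e=1..t. a ^ e / (real e - 0) ^ r)\<bar> \<le> D / (real t + 1)"
    using shifted_partial_sum_tail[of a 0 r] assms by auto
  have "\<bar>real n ^ r * (a * lerch_Phi a r 1)
      - (\<Sum>e=1..t. \<Sum>s<n. a ^ (n * e - s) / (real e - real s / real n) ^ r)\<bar> \<le> (real n ^ r * D) / (real t + 1)" for t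
  proof -
    have "(\<Sum>e=1..t. \<Sum>s<n. a ^ (n * e - s) / (real e - real s / real n) ^ r)
        = (\<Sum>e=1..t. \<Sum>s<n. real n ^ r * (a ^ (n * e - s) / real (n * e - s) ^ r))"
    proof (intro sum.cong refl)
      fix e s assume "e \<in> {1..t}" "s \<in> {..<n}"
      then have "s \<le> n * e" using n by (metis One_nat_def atLeastAtMost_iff lessThan_iff less_or_eq_imp_le mult_le_mono2 nat_mult_1_right order_trans)
      then have "real (n * e - s) = real n * (real e - real s / real n)"
        using n by (simp add: of_nat_diff field_simps)
      then show "a ^ (n * e - s) / (real e - real s / real n) ^ r = real n ^ r * (a ^ (n * e - s) / real (n * e - s) ^ r)"
        using n by (simp add: power_mult_distrib)
    qed
    also have "\<dots> = real n ^ r * (\<Sum>D=1..n * t. a ^ D / real D ^ r)"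
      unfolding sum_distrib_left
      by (rule sum_blocks[of "\<lambda>D. real n ^ r * (a ^ D / real D ^ r)"])
    finally have eq: "(\<Sum>e=1..t. \<Sum>s<n. a ^ (n * e - s) / (real e - real s / real n) ^ r)
        = real n ^ r * (\<Sum>D=1..n * t. a ^ D / real D ^ r)" .
    have D_nonneg: "D \<ge> 0" using D[of 0] by (simp add: order_trans[OF abs_ge_zero])
    have "real t \<le> real (n * t)" using n by (metis mult_1 mult_le_mono1 of_nat_mono)
    then have "D / (real (n * t) + 1) \<le> D / (real t + 1)"
      using D_nonneg by (intro divide_left_mono) auto
    then have "\<bar>a * lerch_Phi a r 1 - (\<Sum>D=1..n * t. a ^ D / real D ^ r)\<bar> \<le> D / (real t + 1)"
      using D[of "n * t"] by simp
    then have "real n ^ r * \<bar>a * lerch_Phi a r 1 - (\<Sum>D=1..n * t. a ^ D / real D ^ r)\<bar> \<le> real n ^ r * (D / (real t + 1))"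
      by (intro mult_left_mono) auto
    then show ?thesis unfolding eq by (simp add: abs_mult flip: right_diff_distrib)
  qed
  then show ?thesis using that by blast
qed

lemma tendsto_if_tail_bound:
  fixes H :: "nat \<Rightarrow> real"
  assumes "\<And>t. \<bar>L - H t\<bar> \<le> D / (real t + 1)"
  shows "H \<longlonglongrightarrow> L"
proof -
  have "(\<lambda>t. L - H t) \<longlonglongrightarrow> 0"
  proof (rule Lim_null_comparison)
    show "(\<lambda>t. D / (real t + 1)) \<longlonglongrightarrow> 0" by real_asymp
  qed (use assms in auto)
  from tendsto_diff[OF tendsto_const[of L] this] show ?thesis by simp
qed

lemma alternating_zeta_partial_sum_tendsto:
  assumes "c \<in> {1, - 1}" "r \<ge> 1" "c = 1 \<Longrightarrow> r \<noteq> 1"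
  shows "(\<lambda>t. \<Sum>e=1..t. c ^ e / real e ^ r) \<longlonglongrightarrow> c * lerch_Phi c r 1"
proof -
  obtain D where "\<And>t. \<bar>c * lerch_Phi c r (1 - 0) - (\<Sum>e=1..t. c ^ e / (real e - 0) ^ r)\<bar> \<le> D / (real t + 1)"
    using shifted_partial_sum_tail[OF assms(1) zero_less_one assms(2,3)] by blast
  from tendsto_if_tail_bound[OF this] show ?thesis by simp
qed

section \<open>Limits of the two families of pole terms\<close>

text \<open>The factors in \<open>u\<close> and in \<open>e\<close> are already separate; the only
  coupling is the range \<open>e \<le> M - u\<close>, a truncated convolution.\<close>

lemma y_poles_tendsto:
  assumes c: "c \<in> {1, - 1}" and b: "b \<in> {1, - 1}" and k: "k \<ge> 1" and s: "s < n"
    and r: "r \<ge> 1" "b = 1 \<Longrightarrow> r \<noteq> 1"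
  shows "(\<lambda>M. \<Sum>u\<in>{- int M..<int M}. \<Sum>e=1..nat (int M - u).
      c powi u / (real_of_int u + real s / real n) ^ k * (b ^ e / (real e - real s / real n) ^ r))
    \<longlonglongrightarrow> bilateral_value c k s n * (b * lerch_Phi b r (1 - real s / real n))"
proof -
  have \<sigma>: "0 \<le> real s / real n" "real s / real n < 1" using s by auto
  obtain C where C: "\<And>u. \<bar>c powi u / (real_of_int u + real s / real n) ^ k\<bar> \<le> C / (1 + \<bar>real_of_int u\<bar>)"
    using bilateral_term_bound[OF c \<sigma> k] by blast
  obtain D where D: "\<And>t. \<bar>b * lerch_Phi b r (1 - real s / real n) - (\<Sum>e=1..t. b ^ e / (real e - real s / real n) ^ r)\<bar> \<le> D / (real t + 1)"
    using shifted_partial_sum_tail[OF b \<sigma>(2) r] by blast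
  show ?thesis
    using tendsto_symmetric_convolution[OF C D bilateral_tendsto[OF c k s]]
    by (simp only: sum_distrib_left)
qed

text \<open>The pole at \<open>u + e = 0\<close> couples the variables. The involution
  \<open>(u, e) \<mapsto> (- u - e, e)\<close> preserves the triangle and moves the pole to
  \<open>u = 0\<close>, while \<open>c powi (- u - e) * a ^ (n * e - s) = a ^ s * (c powi u * b ^
  e)\<close>. After that the \<open>u\<close>-factor is independent of \<open>s\<close> and the
  residues combine into one series.\<close>

lemma z_poles_tendsto:
  assumes a: "a \<in> {1, - 1}" and b: "b \<in> {1, - 1}" and c: "c = a ^ n * b" and i: "i \<ge> 1" and n: "n \<ge> 1"
    and r: "r \<ge> 1" "a = 1 \<Longrightarrow> r \<noteq> 1"
  shows "(\<lambda>M. \<Sum>s<n. a ^ s * (\<Sum>u\<in>{- int M..<int M}. \<Sum>e=1..nat (int M - u).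
      c powi u * b ^ e / ((real_of_int u + real e) ^ i * (real e - real s / real n) ^ r)))
    \<longlonglongrightarrow> (1 + (- 1) ^ i) * (c * lerch_Phi c i 1) * (real n ^ r * (a * lerch_Phi a r 1))"
proof -
  have c': "c \<in> {1, - 1}" using a b by (auto simp: c sign_power uminus_power_if)
  define h where "h e = (\<Sum>s<n. a ^ (n * e - s) / (real e - real s / real n) ^ r)" for e
  have eq: "(\<Sum>s<n. a ^ s * (\<Sum>u\<in>{- int M..<int M}. \<Sum>e=1..nat (int M - u).
        c powi u * b ^ e / ((real_of_int u + real e) ^ i * (real e - real s / real n) ^ r)))
      = (- 1) ^ i * (\<Sum>u\<in>{- int M..<int M}. c powi u / real_of_int u ^ i * (\<Sum>e=1..nat (int M - u). h e))" for M
  proof -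
    let ?J = "SIGMA u:{- int M..<int M}. {1..nat (int M - u)}"
    have "(\<Sum>s<n. a ^ s * (\<Sum>u\<in>{- int M..<int M}. \<Sum>e=1..nat (int M - u).
        c powi u * b ^ e / ((real_of_int u + real e) ^ i * (real e - real s / real n) ^ r)))
      = (\<Sum>s<n. a ^ s * (\<Sum>(u, e)\<in>?J. c powi u * b ^ e / ((real_of_int u + real e) ^ i * (real e - real s / real n) ^ r)))"
      by (simp add: sum.Sigma)
    also have "\<dots> = (\<Sum>s<n. \<Sum>(u, e)\<in>?J. (- 1) ^ i * (c powi u / real_of_int u ^ i) * (a ^ (n * e - s) / (real e - real s / real n) ^ r))"
      unfolding sum_distrib_left
    proof (rule sum.cong, rule refl, rule sum.reindex_bij_witness[of _ "\<lambda>(u, e). (- u - int e, e)" "\<lambda>(u, e). (- u - int e, e)"])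
      fix s x assume s: "s \<in> {..<n}" and "x \<in> ?J"
      then obtain u e where x: "x = (u, e)" and e: "e \<ge> 1" by auto
      have le: "s \<le> n * e" using s e by (metis lessThan_iff less_or_eq_imp_le mult_le_mono2 nat_mult_1_right order_trans)
      have sgn: "c powi (- u - int e) * a ^ (n * e - s) = a ^ s * (c powi u * b ^ e)"
        using a b le by (auto simp: c sign_powi sign_power uminus_power_if)
      have "real_of_int (- u - int e) = - (real_of_int u + real e)" by simp
      then have reflect: "(- 1) ^ i * real_of_int (- u - int e) ^ i = (real_of_int u + real e) ^ i"
        by (simp only: power_minus[of "real_of_int u + real e"]) (simp add: add.commute flip: mult.assoc power_mult_distrib)
      have pw: "(- 1) ^ i / real_of_int (- u - int e) ^ i = 1 / (real_of_int u + real e) ^ i"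
        unfolding reflect[symmetric]
        by (cases "even i") simp_all
      have "(- 1) ^ i * (c powi (- u - int e) / real_of_int (- u - int e) ^ i) * (a ^ (n * e - s) / (real e - real s / real n) ^ r)
          = ((- 1) ^ i / real_of_int (- u - int e) ^ i) * (c powi (- u - int e) * a ^ (n * e - s)) / (real e - real s / real n) ^ r"
        by simp
      also have "\<dots> = a ^ s * (c powi u * b ^ e / ((real_of_int u + real e) ^ i * (real e - real s / real n) ^ r))"
        unfolding pw sgn by simp
      finally show "(case (case x of (u, e) \<Rightarrow> (- u - int e, e)) of (u, e) \<Rightarrow>
            (- 1) ^ i * (c powi u / real_of_int u ^ i) * (a ^ (n * e - s) / (real e - real s / real n) ^ r))
          = a ^ s * (case x of (u, e) \<Rightarrow> c powi u * b ^ e / ((real_of_int u + real e) ^ i * (real e - real s / real n) ^ r))"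
        unfolding x by simp
    qed auto
    also have "\<dots> = (\<Sum>(u, e)\<in>?J. \<Sum>s<n. (- 1) ^ i * (c powi u / real_of_int u ^ i) * (a ^ (n * e - s) / (real e - real s / real n) ^ r))"
      by (subst sum.swap) (simp add: case_prod_unfold)
    also have "\<dots> = (\<Sum>u\<in>{- int M..<int M}. \<Sum>e=1..nat (int M - u). (- 1) ^ i * (c powi u / real_of_int u ^ i) * h e)"
      unfolding h_def sum_distrib_left by (rule sum.Sigma[symmetric]) auto
    finally show ?thesis
      by (simp add: sum_distrib_left mult.assoc)
  qed
  obtain C where C: "\<And>u. \<bar>c powi u / (real_of_int u + 0) ^ i\<bar> \<le> C / (1 + \<bar>real_of_int u\<bar>)"
    using bilateral_term_bound[OF c' _ _ i, of 0] by auto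
  obtain D where D: "\<And>t. \<bar>real n ^ r * (a * lerch_Phi a r 1) - (\<Sum>e=1..t. h e)\<bar> \<le> D / (real t + 1)"
    using block_partial_sum_tail[OF a n r] unfolding h_def by blast
  have "(\<lambda>M. \<Sum>u\<in>{- int M..<int M}. c powi u / real_of_int u ^ i * (\<Sum>e=1..nat (int M - u). h e))
      \<longlonglongrightarrow> c * (1 + (- 1) ^ i) * lerch_Phi c i 1 * (real n ^ r * (a * lerch_Phi a r 1))"
    using tendsto_symmetric_convolution[OF C D] bilateral_tendsto_0[OF c' i] by simp
  \<comment> \<open>The outer sign is absorbed:
    \<open>(- 1) ^ i * (1 + (- 1) ^ i) = 1 + (- 1) ^ i\<close>.\<close>
  from tendsto_mult_left[OF this, of "(- 1) ^ i"] show ?thesis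
    unfolding eq by (cases "even i") (simp_all add: mult_ac)
qed

section \<open>Expansion of the half plane sum into pole terms\<close>

text \<open>Take \<open>y = u + \<sigma>\<close> and \<open>d = e - \<sigma>\<close>: then
  \<open>N = n y\<close> and \<open>m = y + d\<close>, and the signs combine to
  \<open>a ^ s * (c powi u * b ^ e)\<close>. The pole \<open>y = 0\<close> occurs only for
  \<open>s = u = 0\<close>, the pole \<open>m = 0\<close> at \<open>u = - e\<close> for every
  residue.\<close>

lemma lattice_term_partial_fractions:
  fixes n s e :: nat and u :: int
  defines "\<sigma> \<equiv> real s / real n"
  assumes ab: "a \<in> {1, - 1}" "b \<in> {1, - 1}" and pq: "p \<ge> 1" "q \<ge> 1" and n: "s < n" and e: "e \<ge> 1"
    and c: "c = a ^ n * b"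
  shows "lattice_term a b p q (u + int e) (int n * u + int s) = a ^ s / real n ^ q *
     ((\<Sum>k=1..q. real ((p + q - k - 1) choose (p - 1)) * (- 1) ^ (q + k)
         * (c powi u / (real_of_int u + \<sigma>) ^ k * (b ^ e / (real e - \<sigma>) ^ (p + q - k))))
    + (\<Sum>i=1..p. (- 1) ^ q * real ((p + q - i - 1) choose (q - 1))
         * (c powi u * b ^ e / ((real_of_int u + real e) ^ i * (real e - \<sigma>) ^ (p + q - i))))
    - (if s = 0 \<and> u = 0 then (- 1) ^ q * real ((p + q - 1) choose q) * (b ^ e / real e ^ (p + q)) else 0)
    - (if u = - int e then (- 1) ^ q * real ((p + q - 1) choose p) * ((c * b) ^ e / (real e - \<sigma>) ^ (p + q)) else 0))"
proof -
  have n0: "n > 0" using n by simp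
  have \<sigma>: "0 \<le> \<sigma>" "\<sigma> < 1" using n by (auto simp: \<sigma>_def)
  define d where "d = real e - \<sigma>"
  define y where "y = real_of_int u + \<sigma>"
  have d: "d \<noteq> 0" using e \<sigma> by (simp add: d_def)
  have yd: "y + d = real_of_int u + real e" by (simp add: y_def d_def)
  have y0: "y = 0 \<longleftrightarrow> s = 0 \<and> u = 0"
  proof
    assume "y = 0"
    then have "real_of_int u = - \<sigma>" by (simp add: y_def)
    with \<sigma> have "real_of_int u \<le> 0" "real_of_int u > - 1" by auto
    then have "u = 0" by linarith
    with \<open>y = 0\<close> show "s = 0 \<and> u = 0" using n0 by (simp add: y_def \<sigma>_def)
  qed (simp add: y_def \<sigma>_def)
  have z0: "y + d = 0 \<longleftrightarrow> u = - int e" unfolding yd by linarith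
  have sgn: "b powi (u + int e) * a powi (int n * u + int s) = a ^ s * (c powi u * b ^ e)"
    using ab by (auto simp: c sign_powi sign_power uminus_power_if)
  have N: "real_of_int (int n * u + int s) = real n * y"
    using n0 by (simp add: y_def \<sigma>_def field_simps)
  have "lattice_term a b p q (u + int e) (int n * u + int s)
      = a ^ s * (c powi u * b ^ e) / ((y + d) ^ p * (real n * y) ^ q)"
    unfolding lattice_term_def sgn N yd by simp
  also have "\<dots> = a ^ s / real n ^ q * (c powi u * b ^ e * (1 / ((y + d) ^ p * y ^ q)))"
    by (simp add: power_mult_distrib)
  also have "c powi u * b ^ e * (1 / ((y + d) ^ p * y ^ q)) =
      c powi u * b ^ e * (\<Sum>k=1..q. real ((p + q - k - 1) choose (p - 1)) * (- 1) ^ (q + k) / (y ^ k * d ^ (p + q - k)))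
    + c powi u * b ^ e * ((- 1) ^ q * (\<Sum>i=1..p. real ((p + q - i - 1) choose (q - 1)) / ((y + d) ^ i * d ^ (p + q - i))))
    - c powi u * b ^ e * (if y = 0 then (- 1) ^ q * real ((p + q - 1) choose q) / d ^ (p + q) else 0)
    - c powi u * b ^ e * (if y + d = 0 then (- 1) ^ q * real ((p + q - 1) choose p) / d ^ (p + q) else 0)"
    unfolding partial_fractions[OF pq d, of y] by (simp only: distrib_left right_diff_distrib)
  also have "c powi u * b ^ e * (\<Sum>k=1..q. real ((p + q - k - 1) choose (p - 1)) * (- 1) ^ (q + k) / (y ^ k * d ^ (p + q - k)))
      = (\<Sum>k=1..q. real ((p + q - k - 1) choose (p - 1)) * (- 1) ^ (q + k) * (c powi u / y ^ k * (b ^ e / d ^ (p + q - k))))"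
    by (simp add: sum_distrib_left mult_ac)
  also have "c powi u * b ^ e * ((- 1) ^ q * (\<Sum>i=1..p. real ((p + q - i - 1) choose (q - 1)) / ((y + d) ^ i * d ^ (p + q - i))))
      = (\<Sum>i=1..p. (- 1) ^ q * real ((p + q - i - 1) choose (q - 1)) * (c powi u * b ^ e / ((y + d) ^ i * d ^ (p + q - i))))"
    by (simp add: sum_distrib_left mult_ac)
  also have "c powi u * b ^ e * (if y = 0 then (- 1) ^ q * real ((p + q - 1) choose q) / d ^ (p + q) else 0)
      = (if s = 0 \<and> u = 0 then (- 1) ^ q * real ((p + q - 1) choose q) * (b ^ e / real e ^ (p + q)) else 0)"
    unfolding y0 by (simp add: d_def \<sigma>_def)
  also have "c powi u * b ^ e * (if y + d = 0 then (- 1) ^ q * real ((p + q - 1) choose p) / d ^ (p + q) else 0)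
      = (if u = - int e then (- 1) ^ q * real ((p + q - 1) choose p) * ((c * b) ^ e / d ^ (p + q)) else 0)"
  proof -
    have "c powi (- int e) * b ^ e = (c * b) ^ e"
      using ab by (auto simp: c sign_powi sign_power uminus_power_if)
    then show ?thesis unfolding z0 by (auto simp: mult_ac)
  qed
  finally show ?thesis unfolding yd unfolding d_def y_def .
qed

lemma sum_swap_inner:
  fixes f :: "'a \<Rightarrow> 'b \<Rightarrow> 'c \<Rightarrow> 'd::comm_monoid_add"
  shows "(\<Sum>x\<in>A. \<Sum>y\<in>B x. \<Sum>z\<in>C. f x y z) = (\<Sum>z\<in>C. \<Sum>x\<in>A. \<Sum>y\<in>B x. f x y z)"
proof -
  have "(\<Sum>x\<in>A. \<Sum>y\<in>B x. \<Sum>z\<in>C. f x y z) = (\<Sum>x\<in>A. \<Sum>z\<in>C. \<Sum>y\<in>B x. f x y z)"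
    by (intro sum.cong refl sum.swap)
  also have "\<dots> = (\<Sum>z\<in>C. \<Sum>x\<in>A. \<Sum>y\<in>B x. f x y z)"
    by (rule sum.swap)
  finally show ?thesis .
qed

lemma sum_triangle_column:
  fixes h :: "nat \<Rightarrow> real"
  shows "(\<Sum>u\<in>{- int M..<int M}. \<Sum>e=1..nat (int M - u). if u = 0 then h e else 0) = (\<Sum>e=1..M. h e)"
proof -
  have "(\<Sum>u\<in>{- int M..<int M}. \<Sum>e=1..nat (int M - u). if u = 0 then h e else 0)
      = (\<Sum>u\<in>{- int M..<int M}. if u = 0 then \<Sum>e=1..nat (int M - u). h e else 0)"
    by (intro sum.cong refl) auto
  then show ?thesis by (cases "M = 0") auto
qed

text \<open>On \<open>u = - e\<close> the bound \<open>e \<le> M - u\<close> is automatic and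
  \<open>u \<ge> - M\<close> becomes \<open>e \<le> M\<close>.\<close>

lemma sum_triangle_antidiagonal:
  fixes h :: "nat \<Rightarrow> real"
  shows "(\<Sum>u\<in>{- int M..<int M}. \<Sum>e=1..nat (int M - u). if u = - int e then h e else 0) = (\<Sum>e=1..M. h e)"
proof -
  let ?J = "SIGMA u:{- int M..<int M}. {1..nat (int M - u)}"
  have "(\<Sum>u\<in>{- int M..<int M}. \<Sum>e=1..nat (int M - u). if u = - int e then h e else 0)
      = (\<Sum>x\<in>?J. if fst x = - int (snd x) then h (snd x) else 0)"
    by (simp add: sum.Sigma case_prod_unfold)
  also have "\<dots> = (\<Sum>x\<in>{x\<in>?J. fst x = - int (snd x)}. h (snd x))"
    by (rule sum.inter_filter[symmetric]) auto
  also have "\<dots> = (\<Sum>e=1..M. h e)"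
    by (rule sum.reindex_bij_witness[of _ "\<lambda>e. (- int e, e)" snd]) auto
  finally show ?thesis .
qed

text \<open>Linearity, with the corrections reduced to single sums: the one for \<open>N = 0\<close>
  comes from residue 0 alone, the one for \<open>m = 0\<close> from all residues, where
  \<open>(c * b) ^ e = a ^ (n * e)\<close> because \<open>b * b = 1\<close>.\<close>

lemma half_plane_sum_expand:
  fixes a b c :: real
  assumes ab: "a \<in> {1, - 1}" "b \<in> {1, - 1}" and pq: "p \<ge> 1" "q \<ge> 1" and n: "n \<ge> 1" and c: "c = a ^ n * b"
  shows "half_plane_sum a b p q n M = 1 / real n ^ q *
     ((\<Sum>s<n. a ^ s * (\<Sum>k=1..q. real ((p + q - k - 1) choose (p - 1)) * (- 1) ^ (q + k)
         * (\<Sum>u\<in>{- int M..<int M}. \<Sum>e=1..nat (int M - u).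
              c powi u / (real_of_int u + real s / real n) ^ k * (b ^ e / (real e - real s / real n) ^ (p + q - k)))))
    + (\<Sum>i=1..p. (- 1) ^ q * real ((p + q - i - 1) choose (q - 1))
         * (\<Sum>s<n. a ^ s * (\<Sum>u\<in>{- int M..<int M}. \<Sum>e=1..nat (int M - u).
              c powi u * b ^ e / ((real_of_int u + real e) ^ i * (real e - real s / real n) ^ (p + q - i)))))
    - (- 1) ^ q * real ((p + q - 1) choose q) * (\<Sum>e=1..M. b ^ e / real e ^ (p + q))
    - (- 1) ^ q * real ((p + q - 1) choose p)
         * (\<Sum>e=1..M. \<Sum>s<n. a ^ (n * e - s) / (real e - real s / real n) ^ (p + q)))"
proof -
  let ?U = "{- int M..<int M}" and ?E = "\<lambda>u. {1..nat (int M - u)}" and ?w = "p + q"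
  let ?y = "\<lambda>s u e k. c powi u / (real_of_int u + real s / real n) ^ k * (b ^ e / (real e - real s / real n) ^ (?w - k))"
  let ?z = "\<lambda>s u e i. c powi u * b ^ e / ((real_of_int u + real e) ^ i * (real e - real s / real n) ^ (?w - i))"
  let ?K = "\<lambda>k. real ((p + q - k - 1) choose (p - 1)) * (- 1) ^ (q + k)"
  let ?I = "\<lambda>i. (- 1) ^ q * real ((p + q - i - 1) choose (q - 1))"
  let ?c1 = "(- 1) ^ q * real ((p + q - 1) choose q)" and ?c2 = "(- 1) ^ q * real ((p + q - 1) choose p)"
  have inner: "(\<Sum>u\<in>?U. \<Sum>e\<in>?E u. lattice_term a b p q (u + int e) (int n * u + int s))
      = 1 / real n ^ q * (a ^ s * (\<Sum>k=1..q. ?K k * (\<Sum>u\<in>?U. \<Sum>e\<in>?E u. ?y s u e k))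
        + (\<Sum>i=1..p. ?I i * (a ^ s * (\<Sum>u\<in>?U. \<Sum>e\<in>?E u. ?z s u e i)))
        - (if s = 0 then ?c1 * (\<Sum>e=1..M. b ^ e / real e ^ ?w) else 0)
        - ?c2 * (\<Sum>e=1..M. a ^ (n * e - s) / (real e - real s / real n) ^ ?w))"
    if s: "s < n" for s
  proof -
    have "(\<Sum>u\<in>?U. \<Sum>e\<in>?E u. lattice_term a b p q (u + int e) (int n * u + int s))
        = (\<Sum>u\<in>?U. \<Sum>e\<in>?E u. a ^ s / real n ^ q *
           ((\<Sum>k=1..q. ?K k * ?y s u e k) + (\<Sum>i=1..p. ?I i * ?z s u e i)
           - (if u = 0 then if s = 0 then ?c1 * (b ^ e / real e ^ ?w) else 0 else 0)
           - (if u = - int e then ?c2 * ((c * b) ^ e / (real e - real s / real n) ^ ?w) else 0)))"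
      using lattice_term_partial_fractions[OF ab pq s _ c]
      by (intro sum.cong refl) auto
    also have "\<dots> = a ^ s / real n ^ q *
        ((\<Sum>k=1..q. \<Sum>u\<in>?U. \<Sum>e\<in>?E u. ?K k * ?y s u e k)
        + (\<Sum>i=1..p. \<Sum>u\<in>?U. \<Sum>e\<in>?E u. ?I i * ?z s u e i)
        - (\<Sum>e=1..M. if s = 0 then ?c1 * (b ^ e / real e ^ ?w) else 0)
        - (\<Sum>e=1..M. ?c2 * ((c * b) ^ e / (real e - real s / real n) ^ ?w)))"
      unfolding sum_distrib_left[symmetric] sum.distrib sum_subtractf sum_swap_inner
        sum_triangle_column sum_triangle_antidiagonal ..
    also have "(\<Sum>e=1..M. ?c2 * ((c * b) ^ e / (real e - real s / real n) ^ ?w))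
        = a ^ s * (?c2 * (\<Sum>e=1..M. a ^ (n * e - s) / (real e - real s / real n) ^ ?w))"
      unfolding sum_distrib_left
    proof (intro sum.cong refl)
      fix e assume "e \<in> {1..M}"
      then have "s \<le> n * e" using s by (metis atLeastAtMost_iff less_or_eq_imp_le mult_le_mono2 nat_mult_1_right order_trans)
      then have "(c * b) ^ e = a ^ s * a ^ (n * e - s)"
        using ab by (auto simp: c sign_power uminus_power_if)
      then show "?c2 * ((c * b) ^ e / (real e - real s / real n) ^ ?w)
          = a ^ s * (?c2 * (a ^ (n * e - s) / (real e - real s / real n) ^ ?w))"
        by (simp only: ac_simps times_divide_eq_right)
    qed
    \<comment> \<open>The factor \<open>a ^ s\<close> equals 1 for \<open>s = 0\<close>; it is
      inserted so that both corrections carry \<open>a ^ s\<close>, which squares to 1 against the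
      prefactor.\<close>
    also have "(\<Sum>e=1..M. if s = 0 then ?c1 * (b ^ e / real e ^ ?w) else 0)
        = a ^ s * (if s = 0 then ?c1 * (\<Sum>e=1..M. b ^ e / real e ^ ?w) else 0)"
      by (simp add: sum_distrib_left)
    finally have eq: "(\<Sum>u\<in>?U. \<Sum>e\<in>?E u. lattice_term a b p q (u + int e) (int n * u + int s))
        = a ^ s / real n ^ q *
        ((\<Sum>k=1..q. \<Sum>u\<in>?U. \<Sum>e\<in>?E u. ?K k * ?y s u e k)
        + (\<Sum>i=1..p. \<Sum>u\<in>?U. \<Sum>e\<in>?E u. ?I i * ?z s u e i)
        - a ^ s * (if s = 0 then ?c1 * (\<Sum>e=1..M. b ^ e / real e ^ ?w) else 0)
        - a ^ s * (?c2 * (\<Sum>e=1..M. a ^ (n * e - s) / (real e - real s / real n) ^ ?w)))" .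
    have ring: "x / m * (k + i - x * t - x * v) = 1 / m * (x * k + x * i - t - v)"
      if "x * x = 1" for x m k i t v :: real
    proof -
      have "x / m * (k + i - x * t - x * v) = 1 / m * (x * k + x * i - (x * x) * t - (x * x) * v)"
        by (simp add: algebra_simps add_divide_distrib diff_divide_distrib)
      then show ?thesis by (simp add: that)
    qed
    have aa: "a ^ s * a ^ s = 1" using ab by (auto simp: sign_power)
    have z: "a ^ s * (\<Sum>i=1..p. \<Sum>u\<in>?U. \<Sum>e\<in>?E u. ?I i * ?z s u e i)
        = (\<Sum>i=1..p. ?I i * (a ^ s * (\<Sum>u\<in>?U. \<Sum>e\<in>?E u. ?z s u e i)))"
      by (simp only: sum_distrib_left mult.left_commute)
    show ?thesis unfolding eq ring[OF aa] z by (simp only: sum_distrib_left)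
  qed
  have "half_plane_sum a b p q n M = (\<Sum>s<n. 1 / real n ^ q *
      (a ^ s * (\<Sum>k=1..q. ?K k * (\<Sum>u\<in>?U. \<Sum>e\<in>?E u. ?y s u e k))
        + (\<Sum>i=1..p. ?I i * (a ^ s * (\<Sum>u\<in>?U. \<Sum>e\<in>?E u. ?z s u e i)))
        - (if s = 0 then ?c1 * (\<Sum>e=1..M. b ^ e / real e ^ ?w) else 0)
        - ?c2 * (\<Sum>e=1..M. a ^ (n * e - s) / (real e - real s / real n) ^ ?w)))"
    unfolding half_plane_sum_residues[OF n] by (intro sum.cong refl inner) auto
  also have "\<dots> = 1 / real n ^ q *
      ((\<Sum>s<n. a ^ s * (\<Sum>k=1..q. ?K k * (\<Sum>u\<in>?U. \<Sum>e\<in>?E u. ?y s u e k)))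
        + (\<Sum>s<n. \<Sum>i=1..p. ?I i * (a ^ s * (\<Sum>u\<in>?U. \<Sum>e\<in>?E u. ?z s u e i)))
        - (\<Sum>s<n. if s = 0 then ?c1 * (\<Sum>e=1..M. b ^ e / real e ^ ?w) else 0)
        - (\<Sum>s<n. ?c2 * (\<Sum>e=1..M. a ^ (n * e - s) / (real e - real s / real n) ^ ?w)))"
    unfolding sum_distrib_left[symmetric] sum.distrib sum_subtractf ..
  also have "(\<Sum>s<n. \<Sum>i=1..p. ?I i * (a ^ s * (\<Sum>u\<in>?U. \<Sum>e\<in>?E u. ?z s u e i)))
      = (\<Sum>i=1..p. ?I i * (\<Sum>s<n. a ^ s * (\<Sum>u\<in>?U. \<Sum>e\<in>?E u. ?z s u e i)))"
    by (subst sum.swap) (simp only: sum_distrib_left)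
  also have "(\<Sum>s<n. if s = 0 then ?c1 * (\<Sum>e=1..M. b ^ e / real e ^ ?w) else 0)
      = ?c1 * (\<Sum>e=1..M. b ^ e / real e ^ ?w)"
    using n by simp
  also have "(\<Sum>s<n. ?c2 * (\<Sum>e=1..M. a ^ (n * e - s) / (real e - real s / real n) ^ ?w))
      = ?c2 * (\<Sum>e=1..M. \<Sum>s<n. a ^ (n * e - s) / (real e - real s / real n) ^ ?w)"
    unfolding sum_distrib_left[symmetric] by (subst sum.swap) (rule refl)
  finally show ?thesis .
qed

text \<open>The remaining exponents satisfy \<open>p + q - k \<ge> p\<close> and
  \<open>p + q - i \<ge> q\<close>, so the excluded cases \<open>b = 1, p = 1\<close> and
  \<open>a = 1, q = 1\<close> are what keeps every one-sided series convergent.\<close>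

lemma half_plane_sum_tendsto:
  fixes a b c :: real
  assumes ab: "a \<in> {1, - 1}" "b \<in> {1, - 1}" and pq: "p \<ge> 1" "q \<ge> 1" "odd (p + q)" and n: "n \<ge> 1"
    and c: "c = a ^ n * b" and conv: "b = 1 \<Longrightarrow> p \<noteq> 1" "a = 1 \<Longrightarrow> q \<noteq> 1"
  shows "half_plane_sum a b p q n \<longlonglongrightarrow> 1 / real n ^ q *
     ((\<Sum>s<n. a ^ s * (\<Sum>k=1..q. real ((p + q - k - 1) choose (p - 1)) * (- 1) ^ (q + k)
         * (bilateral_value c k s n * (b * lerch_Phi b (p + q - k) (1 - real s / real n)))))
    + (\<Sum>i=1..p. (- 1) ^ q * real ((p + q - i - 1) choose (q - 1))
         * ((1 + (- 1) ^ i) * (c * lerch_Phi c i 1) * (real n ^ (p + q - i) * (a * lerch_Phi a (p + q - i) 1))))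
    - (- 1) ^ q * real ((p + q - 1) choose q) * (b * lerch_Phi b (p + q) 1)
    - (- 1) ^ q * real ((p + q - 1) choose p) * (real n ^ (p + q) * (a * lerch_Phi a (p + q) 1)))"
proof -
  have c': "c \<in> {1, - 1}" using ab by (auto simp: c sign_power uminus_power_if)
  have w: "p + q \<ge> 1" "p + q \<noteq> 1" using pq by auto
  have t3: "(\<lambda>M. \<Sum>e=1..M. b ^ e / real e ^ (p + q)) \<longlonglongrightarrow> b * lerch_Phi b (p + q) 1"
    using ab(2) w by (intro alternating_zeta_partial_sum_tendsto) auto
  obtain D' where D': "\<And>t. \<bar>real n ^ (p + q) * (a * lerch_Phi a (p + q) 1)
      - (\<Sum>e=1..t. \<Sum>s<n. a ^ (n * e - s) / (real e - real s / real n) ^ (p + q))\<bar> \<le> D' / (real t + 1)"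
    using block_partial_sum_tail[OF ab(1) n w(1)] w by blast
  note t4 = tendsto_if_tail_bound[OF D']
  have t1: "(\<lambda>M. \<Sum>u\<in>{- int M..<int M}. \<Sum>e=1..nat (int M - u).
        c powi u / (real_of_int u + real s / real n) ^ k * (b ^ e / (real e - real s / real n) ^ (p + q - k)))
      \<longlonglongrightarrow> bilateral_value c k s n * (b * lerch_Phi b (p + q - k) (1 - real s / real n))"
    if "s \<in> {..<n}" "k \<in> {1..q}" for s k
    using that pq conv by (intro y_poles_tendsto c' ab) auto
  have t2: "(\<lambda>M. \<Sum>s<n. a ^ s * (\<Sum>u\<in>{- int M..<int M}. \<Sum>e=1..nat (int M - u).
        c powi u * b ^ e / ((real_of_int u + real e) ^ i * (real e - real s / real n) ^ (p + q - i))))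
      \<longlonglongrightarrow> (1 + (- 1) ^ i) * (c * lerch_Phi c i 1) * (real n ^ (p + q - i) * (a * lerch_Phi a (p + q - i) 1))"
    if "i \<in> {1..p}" for i
    using that pq conv by (intro z_poles_tendsto c ab n) auto
  show ?thesis
    unfolding half_plane_sum_expand[OF ab pq(1,2) n c, abs_def]
    by (intro tendsto_intros t1 t2 t3 t4)
qed

section \<open>Closed form of the limit\<close>

lemma sum_even_indices:
  fixes f :: "nat \<Rightarrow> real"
  shows "(\<Sum>i=1..m. (1 + (- 1) ^ i) * f i) = 2 * (\<Sum>j=1..m div 2. f (2 * j))"
proof -
  have "(\<Sum>i=1..m. (1 + (- 1) ^ i) * f i) = (\<Sum>i\<in>{i\<in>{1..m}. even i}. 2 * f i)"
    by (subst sum.inter_filter) (auto intro!: sum.cong)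
  also have "\<dots> = (\<Sum>j=1..m div 2. 2 * f (2 * j))"
    by (rule sum.reindex_bij_witness[of _ "\<lambda>j. 2 * j" "\<lambda>i. i div 2"]) auto
  finally show ?thesis by (simp add: sum_distrib_left)
qed

text \<open>The two continued values fit one formula, which lets a pole correction be read as the
  summand with index 0.\<close>

lemma lerch_Phi_0: "c \<in> {1, - 1} \<Longrightarrow> lerch_Phi c 0 1 = - c / 2"
  by (auto simp: lerch_Phi_def)

text \<open>Residue \<open>s = 0\<close> leaves only even \<open>k = 2 j\<close> with
  \<open>j \<ge> 1\<close>; the correction for \<open>N = 0\<close> supplies \<open>j = 0\<close>,
  since \<open>2 * c * lerch_Phi c 0 1 = - 1\<close> and the binomial coefficients agree by
  symmetry. The residues \<open>s \<ge> 1\<close> give the \<open>lerch_Theta\<close> terms.\<close>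

lemma y_poles_eval:
  fixes a b c :: real
  assumes ab: "a \<in> {1, - 1}" "b \<in> {1, - 1}" and pq: "p \<ge> 1" "q \<ge> 1" and n: "n \<ge> 1" and c: "c = a ^ n * b"
  defines "g \<equiv> \<lambda>j. real ((p + q - 2 * j - 1) choose (p - 1)) * lerch_Phi c (2 * j) 1 * lerch_Phi b (p + q - 2 * j) 1"
  shows "(\<Sum>s<n. a ^ s * (\<Sum>k=1..q. real ((p + q - k - 1) choose (p - 1)) * (- 1) ^ (q + k)
         * (bilateral_value c k s n * (b * lerch_Phi b (p + q - k) (1 - real s / real n)))))
      - (- 1) ^ q * real ((p + q - 1) choose q) * (b * lerch_Phi b (p + q) 1)
    = 2 * (- 1) ^ q * c * b * (\<Sum>j=0..q div 2. g j)
      + a * b * (- 1) ^ q * (\<Sum>j=2..n. \<Sum>k=1..q. real ((p + q - k - 1) choose (p - 1)) * a ^ j * (- 1) ^ k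
          * lerch_Theta c k (real j - 1) (real n) * lerch_Phi b (p + q - k) ((real n - real j + 1) / real n))"
proof -
  have c': "c \<in> {1, - 1}" using ab by (auto simp: c sign_power uminus_power_if)
  let ?F = "\<lambda>s. a ^ s * (\<Sum>k=1..q. real ((p + q - k - 1) choose (p - 1)) * (- 1) ^ (q + k)
         * (bilateral_value c k s n * (b * lerch_Phi b (p + q - k) (1 - real s / real n))))"
  have "?F 0 = (\<Sum>k=1..q. (1 + (- 1) ^ k) * ((- 1) ^ q * c * b *
      (real ((p + q - k - 1) choose (p - 1)) * lerch_Phi c k 1 * lerch_Phi b (p + q - k) 1)))"
    unfolding power_0 mult_1_left
    by (intro sum.cong refl) (auto simp: bilateral_value_def power_add uminus_power_if)
  also have "\<dots> = 2 * (- 1) ^ q * c * b * (\<Sum>j=1..q div 2. g j)"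
    unfolding sum_even_indices g_def by (simp add: sum_distrib_left mult.assoc)
  finally have F0: "?F 0 = 2 * (- 1) ^ q * c * b * (\<Sum>j=1..q div 2. g j)" .
  have g0: "- ((- 1) ^ q * real ((p + q - 1) choose q) * (b * lerch_Phi b (p + q) 1)) = 2 * (- 1) ^ q * c * b * g 0"
  proof -
    have "(p + q - 1) choose q = (p + q - 1) choose (p - 1)"
      using binomial_symmetric[of q "p + q - 1"] pq by simp
    then show ?thesis using c' by (auto simp: g_def lerch_Phi_0)
  qed
  have "(\<Sum>s<n. ?F s) = ?F 0 + (\<Sum>s=1..<n. ?F s)"
    using n by (simp add: sum.atLeast_Suc_lessThan lessThan_atLeast0)
  \<comment> \<open>Here \<open>s = j - 1\<close>, and \<open>a * a ^ Suc s = a ^ s\<close> explains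
    the factor \<open>a\<close> in front.\<close>
  also have "(\<Sum>s=1..<n. ?F s) = (\<Sum>j=2..n. a * b * (- 1) ^ q * (\<Sum>k=1..q. real ((p + q - k - 1) choose (p - 1)) * a ^ j * (- 1) ^ k
          * lerch_Theta c k (real j - 1) (real n) * lerch_Phi b (p + q - k) ((real n - real j + 1) / real n)))"
  proof (rule sum.reindex_bij_witness[of _ "\<lambda>j. j - 1" Suc])
    fix s assume s: "s \<in> {1..<n}"
    have eq: "(real n - real (Suc s) + 1) / real n = 1 - real s / real n"
      using n by (simp add: field_simps)
    show "a * b * (- 1) ^ q * (\<Sum>k=1..q. real ((p + q - k - 1) choose (p - 1)) * a ^ Suc s * (- 1) ^ k
          * lerch_Theta c k (real (Suc s) - 1) (real n) * lerch_Phi b (p + q - k) ((real n - real (Suc s) + 1) / real n)) = ?F s"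
      unfolding eq sum_distrib_left
    proof (intro sum.cong refl)
      fix k
      show "a * b * (- 1) ^ q * (real ((p + q - k - 1) choose (p - 1)) * a ^ Suc s * (- 1) ^ k
          * lerch_Theta c k (real (Suc s) - 1) (real n) * lerch_Phi b (p + q - k) (1 - real s / real n))
        = a ^ s * (real ((p + q - k - 1) choose (p - 1)) * (- 1) ^ (q + k)
         * (bilateral_value c k s n * (b * lerch_Phi b (p + q - k) (1 - real s / real n))))"
        using s ab(1) by (auto simp: bilateral_value_def power_add)
    qed
  qed auto
  finally have "(\<Sum>s<n. ?F s) - (- 1) ^ q * real ((p + q - 1) choose q) * (b * lerch_Phi b (p + q) 1)
     = 2 * (- 1) ^ q * c * b * (g 0 + (\<Sum>j=1..q div 2. g j)) + a * b * (- 1) ^ q * (\<Sum>j=2..n. \<Sum>k=1..q. real ((p + q - k - 1) choose (p - 1)) * a ^ j * (- 1) ^ k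
          * lerch_Theta c k (real j - 1) (real n) * lerch_Phi b (p + q - k) ((real n - real j + 1) / real n))"
    unfolding F0 distrib_left g0[symmetric] by (simp add: sum_distrib_left)
  moreover have "(\<Sum>j=0..q div 2. g j) = g 0 + (\<Sum>j=1..q div 2. g j)"
    by (simp add: sum.atLeast_Suc_atMost)
  ultimately show ?thesis by (simp only:)
qed

text \<open>As for the other poles, only even \<open>i = 2 k\<close> survive, and the correction for
  \<open>m = 0\<close> supplies the summand \<open>k = 0\<close>. The power
  \<open>n ^ (p + q - 2 k)\<close> is split to match the factor \<open>n ^ (- 2 k)\<close>.\<close>

lemma z_poles_eval:
  fixes a b c :: real
  assumes ab: "a \<in> {1, - 1}" "b \<in> {1, - 1}" and pq: "p \<ge> 1" "q \<ge> 1" and n: "n \<ge> 1" and c: "c = a ^ n * b"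
  defines "g \<equiv> \<lambda>k. real ((p + q - 2 * k - 1) choose (q - 1)) * real n powi (- 2 * int k) * lerch_Phi c (2 * k) 1 * lerch_Phi a (p + q - 2 * k) 1"
  shows "(\<Sum>i=1..p. (- 1) ^ q * real ((p + q - i - 1) choose (q - 1))
         * ((1 + (- 1) ^ i) * (c * lerch_Phi c i 1) * (real n ^ (p + q - i) * (a * lerch_Phi a (p + q - i) 1))))
      - (- 1) ^ q * real ((p + q - 1) choose p) * (real n ^ (p + q) * (a * lerch_Phi a (p + q) 1))
    = 2 * (- 1) ^ q * a * c * real n ^ (p + q) * (\<Sum>k=0..p div 2. g k)"
proof -
  have c': "c \<in> {1, - 1}" using ab by (auto simp: c sign_power uminus_power_if)
  have "(\<Sum>i=1..p. (- 1) ^ q * real ((p + q - i - 1) choose (q - 1))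
         * ((1 + (- 1) ^ i) * (c * lerch_Phi c i 1) * (real n ^ (p + q - i) * (a * lerch_Phi a (p + q - i) 1))))
      = (\<Sum>i=1..p. (1 + (- 1) ^ i) * ((- 1) ^ q * real ((p + q - i - 1) choose (q - 1))
         * ((c * lerch_Phi c i 1) * (real n ^ (p + q - i) * (a * lerch_Phi a (p + q - i) 1)))))"
    by (simp only: mult.left_commute mult.assoc)
  also have "\<dots> = 2 * (\<Sum>j=1..p div 2. (- 1) ^ q * a * c * real n ^ (p + q) * g j)"
    unfolding sum_even_indices
  proof (intro arg_cong[of _ _ "\<lambda>x. 2 * x"] sum.cong refl)
    fix j assume "j \<in> {1..p div 2}"
    then have j: "2 * j \<le> p + q" by auto
    have pw: "real n ^ (p + q) * real n powi (- 2 * int j) = real n ^ (p + q - 2 * j)"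
    proof -
      have "real n powi (- 2 * int j) = 1 / real n ^ (2 * j)"
      proof -
        have "- 2 * int j = - int (2 * j)" by simp
        then show ?thesis by (simp only: power_int_minus power_int_of_nat inverse_eq_divide)
      qed
      then show ?thesis using n j by (simp add: power_diff)
    qed
    show "(- 1) ^ q * real ((p + q - 2 * j - 1) choose (q - 1))
         * ((c * lerch_Phi c (2 * j) 1) * (real n ^ (p + q - 2 * j) * (a * lerch_Phi a (p + q - 2 * j) 1)))
       = (- 1) ^ q * a * c * real n ^ (p + q) * g j"
      unfolding g_def pw[symmetric] by (simp only: ac_simps)
  qed
  finally have sum: "(\<Sum>i=1..p. (- 1) ^ q * real ((p + q - i - 1) choose (q - 1))
         * ((1 + (- 1) ^ i) * (c * lerch_Phi c i 1) * (real n ^ (p + q - i) * (a * lerch_Phi a (p + q - i) 1))))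
      = 2 * (- 1) ^ q * a * c * real n ^ (p + q) * (\<Sum>k=1..p div 2. g k)"
    by (simp add: sum_distrib_left mult.assoc)
  have g0: "- ((- 1) ^ q * real ((p + q - 1) choose p) * (real n ^ (p + q) * (a * lerch_Phi a (p + q) 1)))
      = 2 * (- 1) ^ q * a * c * real n ^ (p + q) * g 0"
  proof -
    have "(p + q - 1) choose p = (p + q - 1) choose (q - 1)"
      using binomial_symmetric[of p "p + q - 1"] pq by simp
    then show ?thesis using c' by (auto simp: g_def lerch_Phi_0)
  qed
  have "(\<Sum>k=0..p div 2. g k) = g 0 + (\<Sum>k=1..p div 2. g k)"
    by (simp add: sum.atLeast_Suc_atMost)
  then show ?thesis
    unfolding sum by (simp only: distrib_left g0[symmetric])
qed

section \<open>Assembly of the identity from the cone and half plane limits\<close>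

theorem theorem7:
  fixes p q n :: nat and a b :: real
  assumes "p \<ge> 1" and "q \<ge> 1" and "n \<ge> 1"
    and "odd (p + q)"
    and "a \<in> {1, - 1}" and "b \<in> {1, - 1}"
    and "b = 1 \<Longrightarrow> p \<noteq> 1"
    and "a = 1 \<Longrightarrow> q \<noteq> 1"
  shows
    "(\<lambda>i. let k = Suc i in
        (a ^ n) ^ k * gen_harm p b k
          * (\<Sum>j=1..n. a ^ (j - 1) / (real n * real k + real j) ^ q))
     sums
     (- (1 / 2) * a ^ (n - 1) * real n powi (- int q) * lerch_Phi (a ^ n * b) (p + q) 1
      + 1 / 2 * (1 + (- 1) ^ q) * lerch_Phi a q 1 * lerch_Phi b p 1
      - a ^ (n - 1) * b * (- real n) powi (- int q)
          * (\<Sum>j=0..q div 2. real ((p + q - 2 * j - 1) choose (p - 1))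
               * lerch_Phi (a ^ n * b) (2 * j) 1 * lerch_Phi b (p + q - 2 * j) 1)
      + a ^ n * (- real n) ^ p
          * (\<Sum>k=0..p div 2. real ((p + q - 2 * k - 1) choose (q - 1))
               * real n powi (- 2 * int k)
               * lerch_Phi (a ^ n * b) (2 * k) 1 * lerch_Phi a (p + q - 2 * k) 1)
      - 1 / 2 * (- real n) powi (- int q)
          * (\<Sum>j=2..n. \<Sum>k=1..q. real ((p + q - k - 1) choose (p - 1))
               * a ^ j * (- 1) ^ k
               * lerch_Theta (a ^ n * b) k (real j - 1) (real n)
               * lerch_Phi b (p + q - k) ((real n - real j + 1) / real n)))"
proof -
  define c where "c = a ^ n * b"
  note pos = \<open>p \<ge> 1\<close> \<open>q \<ge> 1\<close> and n = \<open>n \<ge> 1\<close>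
  note ab = \<open>a \<in> {1, - 1}\<close> \<open>b \<in> {1, - 1}\<close> and conv = assms(7,8)
  have c': "c \<in> {1, - 1}" using ab by (auto simp: c_def sign_power uminus_power_if)
  define Y where "Y = (\<Sum>j=0..q div 2. real ((p + q - 2 * j - 1) choose (p - 1))
      * lerch_Phi c (2 * j) 1 * lerch_Phi b (p + q - 2 * j) 1)"
  define Z where "Z = (\<Sum>k=0..p div 2. real ((p + q - 2 * k - 1) choose (q - 1))
      * real n powi (- 2 * int k) * lerch_Phi c (2 * k) 1 * lerch_Phi a (p + q - 2 * k) 1)"
  define T where "T = (\<Sum>j=2..n. \<Sum>k=1..q. real ((p + q - k - 1) choose (p - 1)) * a ^ j * (- 1) ^ k
      * lerch_Theta c k (real j - 1) (real n) * lerch_Phi b (p + q - k) ((real n - real j + 1) / real n))"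
  have regroup: "x + z - s - t = (x - s) + (z - t)" for x z s t :: real by simp
  have half: "half_plane_sum a b p q n \<longlonglongrightarrow> 1 / real n ^ q *
      (2 * (- 1) ^ q * c * b * Y + a * b * (- 1) ^ q * T + 2 * (- 1) ^ q * a * c * real n ^ (p + q) * Z)"
    unfolding Y_def Z_def T_def y_poles_eval[OF ab pos n c_def, symmetric] z_poles_eval[OF ab pos n c_def, symmetric]
    by (rule tendsto_eq_rhs, rule half_plane_sum_tendsto[OF ab pos \<open>odd (p + q)\<close> n c_def],
        (rule conv, assumption)+, rule arg_cong[of _ _ "\<lambda>x. 1 / real n ^ q * x"], rule regroup)
  \<comment> \<open>The second factor of the product is truncated at \<open>n * M\<close>, so its
    limit is taken along a subsequence.\<close>
  have mult_n: "filterlim (\<lambda>M. n * M) sequentially sequentially"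
    using n by (intro filterlim_subseq strict_monoI) auto
  have prod: "(\<lambda>M. (\<Sum>m=1..M. b ^ m / real m ^ p) * (\<Sum>N=1..n * M. a ^ N / real N ^ q))
      \<longlonglongrightarrow> (b * lerch_Phi b p 1) * (a * lerch_Phi a q 1)"
    using pos conv ab
    by (intro tendsto_mult alternating_zeta_partial_sum_tendsto filterlim_compose[OF alternating_zeta_partial_sum_tendsto mult_n]) auto
  have diag: "(\<lambda>M. \<Sum>m=1..M. (a ^ n * b) ^ m / real m ^ (p + q)) \<longlonglongrightarrow> c * lerch_Phi c (p + q) 1"
    using alternating_zeta_partial_sum_tendsto[OF c', of "p + q"] pos by (simp add: c_def)
  have "(\<lambda>M. 1 / 2 * ((1 + (- 1) ^ q) * ((\<Sum>m=1..M. b ^ m / real m ^ p) * (\<Sum>N=1..n * M. a ^ N / real N ^ q))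
      - (\<Sum>m=1..M. (a ^ n * b) ^ m / real m ^ (p + q)) / real n ^ q - half_plane_sum a b p q n M))
    \<longlonglongrightarrow> 1 / 2 * ((1 + (- 1) ^ q) * ((b * lerch_Phi b p 1) * (a * lerch_Phi a q 1))
      - (c * lerch_Phi c (p + q) 1) / real n ^ q - 1 / real n ^ q *
      (2 * (- 1) ^ q * c * b * Y + a * b * (- 1) ^ q * T + 2 * (- 1) ^ q * a * c * real n ^ (p + q) * Z))"
    using n by (intro tendsto_intros prod diag half) auto
  then have cone: "cone_sum a b p q n
    \<longlonglongrightarrow> 1 / 2 * ((1 + (- 1) ^ q) * ((b * lerch_Phi b p 1) * (a * lerch_Phi a q 1))
      - (c * lerch_Phi c (p + q) 1) / real n ^ q - 1 / real n ^ q *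
      (2 * (- 1) ^ q * c * b * Y + a * b * (- 1) ^ q * T + 2 * (- 1) ^ q * a * c * real n ^ (p + q) * Z))"
    unfolding cone_half_plane_decomposition[OF ab pos \<open>odd (p + q)\<close> n, symmetric] by simp
  \<comment> \<open>The first \<open>M\<close> terms of the series fill the cone in the box of size
    \<open>Suc M\<close>, hence the shift.\<close>
  have scaled: "(\<lambda>M. a * b * cone_sum a b p q n (Suc M)) \<longlonglongrightarrow> a * b * (1 / 2 * ((1 + (- 1) ^ q) * ((b * lerch_Phi b p 1) * (a * lerch_Phi a q 1))
      - (c * lerch_Phi c (p + q) 1) / real n ^ q - 1 / real n ^ q *
      (2 * (- 1) ^ q * c * b * Y + a * b * (- 1) ^ q * T + 2 * (- 1) ^ q * a * c * real n ^ (p + q) * Z)))"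
    by (intro tendsto_mult_left LIMSEQ_Suc cone)
  define e where "e = (- 1 :: real) ^ q"
  have e: "e = 1 \<or> e = - 1" by (auto simp: e_def uminus_power_if)
  have powi: "real n powi (- int q) = 1 / real n ^ q" "(- real n) powi (- int q) = e / real n ^ q"
    by (auto simp: e_def power_int_minus power_int_of_nat inverse_eq_divide uminus_power_if)
  \<comment> \<open>As \<open>p + q\<close> is odd,
    \<open>(- 1) ^ p = - ((- 1) ^ q)\<close>.\<close>
  have pow_p: "(- real n) ^ p = - (e * real n ^ p)"
    using \<open>odd (p + q)\<close> by (auto simp: e_def uminus_power_if)
  \<comment> \<open>Splitting off one factor exposes \<open>a * b * c = a ^ (n - 1)\<close>, from
    which the coefficients of the diagonal and of \<open>Y\<close> arise.\<close>
  have an: "a ^ n = a * a ^ (n - 1)" using n by (cases n) auto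
  have closed_form: "a * b * (1 / 2 * ((1 + (- 1) ^ q) * ((b * lerch_Phi b p 1) * (a * lerch_Phi a q 1))
      - (c * lerch_Phi c (p + q) 1) / real n ^ q - 1 / real n ^ q *
      (2 * (- 1) ^ q * c * b * Y + a * b * (- 1) ^ q * T + 2 * (- 1) ^ q * a * c * real n ^ (p + q) * Z)))
    = - (1 / 2) * a ^ (n - 1) * real n powi (- int q) * lerch_Phi c (p + q) 1
      + 1 / 2 * (1 + (- 1) ^ q) * lerch_Phi a q 1 * lerch_Phi b p 1
      - a ^ (n - 1) * b * (- real n) powi (- int q) * Y
      + a ^ n * (- real n) ^ p * Z
      - 1 / 2 * (- real n) powi (- int q) * T"
    unfolding powi pow_p c_def an power_add e_def[symmetric]
    using n ab e by (auto simp: field_simps)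
  show ?thesis
    unfolding sums_def cone_sum_eq_partial_sum[OF ab]
    using scaled unfolding closed_form unfolding Y_def Z_def T_def c_def .
qed

end
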